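(* Let $G$ be a 3-connected graph that is not isomorphic to $K_4$. Then $G$ is uniquely defined by its truncated cycle matroid: if $F$ is a graph with $E(F)=E(G)$ and $M_t(F)=M_t(G)$, then $F$ and $G$ are strongly isomorphic. Here all graphs are finite, with no loops, no parallel edges and no isolated vertices.
   Context: A graph is a triple $(V,E,\phi)$ with $V\neq\emptyset$ and $E$ disjoint finite sets and $\phi:E\to\binom{V}{2}$ giving the two end-vertices of each edge. A 3-connected graph has at least four vertices and cannot be disconnected by deleting fewer than three vertices. The cycle matroid $M(G)$ is the matroid on the ground set $E(G)$ whose bases are the edge sets of maximal forests of $G$. For a matroid $M$ with set of bases $\mathcal{B}(M)$, the truncation $M_t$ is the matroid on the same ground set with set of bases $\{B\setminus\{x\}: B\in\mathcal{B}(M),\ x\in B\}$. The truncated cycle matroid of $G$ is $M_t(G)=(M(G))_t$. Equality of matroids means equality as matroids on the same labelled ground set. A vertex star in a graph is the set of edges incident to one vertex. Two graphs are strongly isomorphic if they have the same family of vertex stars (so they have the same edge set and differ only in the names of vertices). *)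

theory Defs
  imports Main "HOL-Library.Multiset"
begin

text \<open>
  Vertices and edges live in two separate types, so the disjointness of the vertex set and
  the edge set needs no assumption. The value of \<open>end_vertices\<close> outside the edge set is
  irrelevant.
\<close>

record ('v, 'e) graph =
  vertex_set :: "'v set"
  edge_set :: "'e set"
  end_vertices :: "'e \<Rightarrow> 'v set"

text \<open>Loops are excluded here, since every edge has two distinct ends; parallel edges are not.\<close>

definition is_graph :: "('v, 'e) graph \<Rightarrow> bool" where
  "is_graph G \<longleftrightarrow>
     vertex_set G \<noteq> {} \<and> finite (vertex_set G) \<and> finite (edge_set G) \<and>
     (\<forall>e\<in>edge_set G. end_vertices G e \<subseteq> vertex_set G \<and> card (end_vertices G e) = 2)"

definition no_parallel_edges :: "('v, 'e) graph \<Rightarrow> bool" where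
  "no_parallel_edges G \<longleftrightarrow> inj_on (end_vertices G) (edge_set G)"

definition vertex_star :: "('v, 'e) graph \<Rightarrow> 'v \<Rightarrow> 'e set" where
  "vertex_star G v = {e \<in> edge_set G. v \<in> end_vertices G e}"

definition no_isolated_vertices :: "('v, 'e) graph \<Rightarrow> bool" where
  "no_isolated_vertices G \<longleftrightarrow> (\<forall>v\<in>vertex_set G. vertex_star G v \<noteq> {})"

definition admissible_graph :: "('v, 'e) graph \<Rightarrow> bool" where
  "admissible_graph G \<longleftrightarrow> is_graph G \<and> no_parallel_edges G \<and> no_isolated_vertices G"

definition adjacency :: "('v, 'e) graph \<Rightarrow> ('v \<times> 'v) set" where
  "adjacency G = {(u, v). \<exists>e\<in>edge_set G. end_vertices G e = {u, v}}"

definition connected_graph :: "('v, 'e) graph \<Rightarrow> bool" where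
  "connected_graph G \<longleftrightarrow> (\<forall>u\<in>vertex_set G. \<forall>v\<in>vertex_set G. (u, v) \<in> (adjacency G)\<^sup>*)"

definition delete_vertices :: "('v, 'e) graph \<Rightarrow> 'v set \<Rightarrow> ('v, 'e) graph" where
  "delete_vertices G X =
     \<lparr>vertex_set = vertex_set G - X,
      edge_set = {e \<in> edge_set G. end_vertices G e \<inter> X = {}},
      end_vertices = end_vertices G\<rparr>"

definition three_connected :: "('v, 'e) graph \<Rightarrow> bool" where
  "three_connected G \<longleftrightarrow>
     card (vertex_set G) \<ge> 4 \<and>
     (\<forall>X. X \<subseteq> vertex_set G \<and> card X < 3 \<longrightarrow> connected_graph (delete_vertices G X))"

definition isomorphic_graphs :: "('v, 'e) graph \<Rightarrow> ('w, 'f) graph \<Rightarrow> bool" where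
  "isomorphic_graphs G H \<longleftrightarrow>
     (\<exists>f g. bij_betw f (vertex_set G) (vertex_set H) \<and> bij_betw g (edge_set G) (edge_set H) \<and>
        (\<forall>e\<in>edge_set G. end_vertices H (g e) = f ` end_vertices G e))"

definition complete_graph :: "nat \<Rightarrow> (nat, nat set) graph" where
  "complete_graph n =
     \<lparr>vertex_set = {..<n}, edge_set = {e. e \<subseteq> {..<n} \<and> card e = 2}, end_vertices = id\<rparr>"

text \<open>
  The edges \<open>es ! i\<close> form a cycle through the vertices \<open>vs ! i\<close>. Two parallel edges count as a
  cycle of length 2.
\<close>

definition is_cycle :: "('v, 'e) graph \<Rightarrow> 'v list \<Rightarrow> 'e list \<Rightarrow> bool" where
  "is_cycle G vs es \<longleftrightarrow>
     length es \<ge> 2 \<and> length vs = length es \<and> distinct vs \<and> distinct es \<and>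
     set vs \<subseteq> vertex_set G \<and> set es \<subseteq> edge_set G \<and>
     (\<forall>i<length es. end_vertices G (es ! i) = {vs ! i, vs ! (Suc i mod length es)})"

definition forest_edges :: "('v, 'e) graph \<Rightarrow> 'e set \<Rightarrow> bool" where
  "forest_edges G A \<longleftrightarrow> A \<subseteq> edge_set G \<and> \<not> (\<exists>vs es. is_cycle G vs es \<and> set es \<subseteq> A)"

definition maximal_forest_edges :: "('v, 'e) graph \<Rightarrow> 'e set \<Rightarrow> bool" where
  "maximal_forest_edges G A \<longleftrightarrow> forest_edges G A \<and> (\<forall>A'. forest_edges G A' \<and> A \<subseteq> A' \<longrightarrow> A' = A)"

text \<open>
  A matroid is given by its ground set and its set of bases. The basis axioms are not imposed
  on the record, but they hold for the cycle matroid of a graph and, in positive rank, for its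
  truncation; equality of records is equality of matroids on the same labelled ground set.
\<close>

record 'e matroid =
  ground_set :: "'e set"
  bases :: "'e set set"

definition cycle_matroid :: "('v, 'e) graph \<Rightarrow> 'e matroid" where
  "cycle_matroid G = \<lparr>ground_set = edge_set G, bases = {B. maximal_forest_edges G B}\<rparr>"

definition truncation :: "'e matroid \<Rightarrow> 'e matroid" where
  "truncation M =
     \<lparr>ground_set = ground_set M, bases = {B - {x} | B x. B \<in> bases M \<and> x \<in> B}\<rparr>"

definition truncated_cycle_matroid :: "('v, 'e) graph \<Rightarrow> 'e matroid" where
  "truncated_cycle_matroid G = truncation (cycle_matroid G)"

text \<open>
  The family of vertex stars is the family indexed by the vertices, taken up to renaming of the
  indices, that is, a multiset: the two ends of an isolated edge have the same star, which then
  occurs twice.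
\<close>

definition vertex_stars :: "('v, 'e) graph \<Rightarrow> 'e set multiset" where
  "vertex_stars G = image_mset (vertex_star G) (mset_set (vertex_set G))"

definition strongly_isomorphic :: "('v, 'e) graph \<Rightarrow> ('w, 'e) graph \<Rightarrow> bool" where
  "strongly_isomorphic F G \<longleftrightarrow> vertex_stars F = vertex_stars G"

end

theory Submission
  imports Defs
begin

text \<open>
  Let \<open>G\<close> have \<open>n\<close> vertices. Then \<open>n \<ge> 5\<close>, as \<open>K\<^sub>4\<close> is the only 3-connected graph on four vertices.
  The truncation keeps the circuits with at most \<open>n - 2\<close> edges, and these generate the cycle space of
  \<open>G\<close> over the field with two elements: a longer circuit either has a chord, and is the sum of two
  smaller circuits, or is the rim of a wheel, and is the sum of the triangles at the hub. So the
  cycle space of \<open>G\<close> lies in that of \<open>F\<close>, and the two are equal because the ranks agree.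

  For a vertex \<open>v\<close> of \<open>G\<close>, 2-connectedness of \<open>G - v\<close> forces the edges of \<open>G - v\<close> to lie on one side
  of the cut of \<open>F\<close> formed by the star of \<open>v\<close>. So this star contains the star of a vertex of \<open>F\<close>,
  and the two are equal because the star of \<open>v\<close> is a minimal cut of \<open>G\<close>.
\<close>

subsection \<open>Families of sets closed under symmetric difference\<close>

lemma odd_card_sym_diff:
  assumes "finite A" "finite B"
  shows "odd (card (sym_diff A B)) \<longleftrightarrow> odd (card A) \<noteq> odd (card B)"
proof -
  have "card (sym_diff A B) = card (A - B) + card (B - A)"
    using assms by (intro card_Un_disjoint) auto
  moreover have "card A = card (A - B) + card (A \<inter> B)"
    using assms card_Int_Diff[of A B] by simp
  moreover have "card B = card (B - A) + card (A \<inter> B)"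
    using assms card_Int_Diff[of B A] by (simp add: Int_commute)
  ultimately show ?thesis by auto
qed

text \<open>A subspace of the power set of \<open>E\<close> over the field with two elements. It
  presents the matroid whose circuits are the minimal nonempty members of \<open>Z\<close>, so
  \<open>F\<close> and \<open>G\<close> can be compared as two subspaces over one ground
  set.\<close>

locale binary_space =
  fixes E :: "'e set" and Z :: "'e set set"
  assumes finite_E: "finite E"
    and Z_subset: "C \<in> Z \<Longrightarrow> C \<subseteq> E"
    and empty_Z: "{} \<in> Z"
    and sym_diff_Z: "C \<in> Z \<Longrightarrow> D \<in> Z \<Longrightarrow> sym_diff C D \<in> Z"
begin

definition indep :: "'e set \<Rightarrow> bool" where
  "indep A \<longleftrightarrow> A \<subseteq> E \<and> (\<forall>C\<in>Z. C \<subseteq> A \<longrightarrow> C = {})"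

definition basis :: "'e set \<Rightarrow> bool" where
  "basis B \<longleftrightarrow> indep B \<and> (\<forall>A. indep A \<and> B \<subseteq> A \<longrightarrow> A = B)"

lemma indep_mono: "indep A \<Longrightarrow> B \<subseteq> A \<Longrightarrow> indep B"
  unfolding indep_def by blast

lemma indep_finite: "indep A \<Longrightarrow> finite A"
  unfolding indep_def using finite_E finite_subset by blast

lemma indep_extend:
  assumes "indep A"
  obtains B where "basis B" "A \<subseteq> B"
proof -
  let ?S = "{B. indep B \<and> A \<subseteq> B}"
  have "finite ?S"
    by (rule finite_subset[of _ "Pow E"]) (auto simp: indep_def finite_E)
  moreover have "A \<in> ?S" using assms by simp
  ultimately obtain B where "B \<in> ?S" "\<forall>A'\<in>?S. B \<subseteq> A' \<longrightarrow> A' = B"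
    by (metis (no_types, lifting) finite_has_maximal2)
  then have "basis B" "A \<subseteq> B" unfolding basis_def by blast+
  then show ?thesis using that by blast
qed

text \<open>By maximality of \<open>B\<close>, an element \<open>e\<close> outside \<open>B\<close>
  completes a nonempty member of \<open>Z\<close> inside \<open>insert e B\<close>; hence
  \<open>e\<close> is congruent modulo \<open>Z\<close> to a part of \<open>B\<close>. The general
  case adds up single elements.\<close>

lemma basis_represents:
  assumes B: "basis B" and "A \<subseteq> E"
  obtains P where "P \<subseteq> B" "sym_diff A P \<in> Z"
proof -
  have "finite A" using assms(2) finite_E finite_subset by blast
  then have "\<exists>P\<subseteq>B. sym_diff A P \<in> Z" using assms(2)
  proof (induction A)
    case empty
    then show ?case using empty_Z by auto
  next
    case (insert e A)
    then obtain P where P: "P \<subseteq> B" "sym_diff A P \<in> Z" by auto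
    have "\<exists>Q\<subseteq>B. sym_diff {e} Q \<in> Z"
    proof (cases "e \<in> B")
      case True
      then show ?thesis using empty_Z by (intro exI[of _ "{e}"]) auto
    next
      case False
      then have "\<not> indep (insert e B)" using B unfolding basis_def by blast
      then obtain C where C: "C \<in> Z" "C \<subseteq> insert e B" "C \<noteq> {}"
        using insert.prems B unfolding basis_def indep_def by blast
      have "e \<in> C" using C B unfolding basis_def indep_def by blast
      then have "sym_diff {e} (C - {e}) = C" by blast
      then show ?thesis using C by (intro exI[of _ "C - {e}"]) auto
    qed
    then obtain Q where Q: "Q \<subseteq> B" "sym_diff {e} Q \<in> Z" by blast
    have "sym_diff (insert e A) (sym_diff P Q) = sym_diff (sym_diff A P) (sym_diff {e} Q)"
      using insert.hyps(2) by blast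
    then have "sym_diff (insert e A) (sym_diff P Q) \<in> Z"
      using sym_diff_Z[OF P(2) Q(2)] by simp
    moreover have "sym_diff P Q \<subseteq> B" using P Q by blast
    ultimately show ?case by blast
  qed
  then show ?thesis using that by blast
qed

text \<open>Reduction modulo \<open>Z\<close> embeds the power set of \<open>A\<close> into the power set of \<open>B\<close>.\<close>

lemma indep_card_le_basis:
  assumes B: "basis B" and A: "indep A"
  shows "card A \<le> card B"
proof -
  have "\<forall>X\<in>Pow A. \<exists>P. P \<subseteq> B \<and> sym_diff X P \<in> Z"
    using basis_represents[OF B] A unfolding indep_def by (metis PowD subset_trans)
  then obtain f where f: "\<And>X. X \<subseteq> A \<Longrightarrow> f X \<subseteq> B \<and> sym_diff X (f X) \<in> Z"
    by (metis PowI)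
  have "inj_on f (Pow A)"
  proof (rule inj_onI)
    fix X Y assume XY: "X \<in> Pow A" "Y \<in> Pow A" "f X = f Y"
    then have "sym_diff (sym_diff X (f X)) (sym_diff Y (f X)) \<in> Z"
      using f sym_diff_Z by (metis PowD)
    moreover have "sym_diff (sym_diff X (f X)) (sym_diff Y (f X)) = sym_diff X Y" by blast
    ultimately have "sym_diff X Y \<in> Z" by simp
    moreover have "sym_diff X Y \<subseteq> A" using XY by blast
    ultimately have "sym_diff X Y = {}" using A unfolding indep_def by blast
    then show "X = Y" by blast
  qed
  moreover have "f ` Pow A \<subseteq> Pow B" using f by blast
  moreover have finB: "finite B" using B indep_finite unfolding basis_def by blast
  ultimately have "card (Pow A) \<le> card (Pow B)" by (intro card_inj_on_le[of f]) auto
  then have "(2::nat) ^ card A \<le> 2 ^ card B"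
    using indep_finite[OF A] finB by (simp add: card_Pow)
  then show ?thesis by simp
qed

lemma basis_card_eq: "basis A \<Longrightarrow> basis B \<Longrightarrow> card A = card B"
  using indep_card_le_basis unfolding basis_def by (meson le_antisym)

lemma indep_card_eq_basis:
  assumes "basis B" "indep A" "card A = card B"
  shows "basis A"
  using assms indep_card_le_basis indep_finite card_seteq
  unfolding basis_def by metis

definition truncated_bases :: "'e set set" where
  "truncated_bases = {B - {x} | B x. basis B \<and> x \<in> B}"

text \<open>An independent set below the rank extends to a basis with an element to spare, and that
  element can be the one deleted. Truncation therefore loses nothing about sets smaller than the
  rank.\<close>

lemma indep_small_iff_truncated:
  assumes B: "basis B" and "card A < card B"
  shows "indep A \<longleftrightarrow> (\<exists>T\<in>truncated_bases. A \<subseteq> T)"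
proof
  assume "indep A"
  then obtain C where C: "basis C" "A \<subseteq> C" using indep_extend by blast
  then have "card A < card C" using assms basis_card_eq by metis
  then obtain x where "x \<in> C" "x \<notin> A" using C by (metis less_irrefl subsetI subset_antisym)
  then have "C - {x} \<in> truncated_bases" "A \<subseteq> C - {x}"
    unfolding truncated_bases_def using C by blast+
  then show "\<exists>T\<in>truncated_bases. A \<subseteq> T" by blast
next
  assume "\<exists>T\<in>truncated_bases. A \<subseteq> T"
  then obtain C where "basis C" "A \<subseteq> C" unfolding truncated_bases_def by blast
  then show "indep A" using indep_mono unfolding basis_def by blast
qed

end

text \<open>The junk case of rank \<open>0\<close>, where there are no truncated bases, is excluded by \<open>B \<noteq> {}\<close>.\<close>

lemma truncated_bases_same_rank:
  assumes "binary_space E Z" "binary_space E Z'"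
    and eq: "binary_space.truncated_bases E Z = binary_space.truncated_bases E Z'"
    and B: "binary_space.basis E Z B" "B \<noteq> {}" and B': "binary_space.basis E Z' B'"
  shows "card B' = card B"
proof -
  interpret binary_space E Z by fact
  interpret b: binary_space E Z' by fact
  obtain x where x: "x \<in> B" using B by blast
  then have "B - {x} \<in> b.truncated_bases" using B eq unfolding truncated_bases_def by blast
  then obtain C y where C: "b.basis C" "y \<in> C" "B - {x} = C - {y}"
    unfolding b.truncated_bases_def by blast
  have fin: "finite B" "finite C"
    using B(1) C(1) indep_finite[of B] b.indep_finite[of C]
    unfolding basis_def b.basis_def by simp_all
  then have "card B = card C" using card.remove[OF fin(1) x] card.remove[OF fin(2) C(2)] C(3) by simp
  then show ?thesis using b.basis_card_eq[OF C(1) B'] by simp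
qed

text \<open>A dimension count. Fewer dependencies mean more independent sets, so \<open>B'\<close>
  is also independent for \<open>Z\<close>, and by its size a basis there.\<close>

lemma binary_space_eqI:
  assumes "binary_space E Z" "binary_space E Z'" and sub: "Z \<subseteq> Z'"
    and B: "binary_space.basis E Z B" and B': "binary_space.basis E Z' B'"
    and "card B' = card B"
  shows "Z = Z'"
proof
  interpret binary_space E Z by fact
  interpret b: binary_space E Z' by fact
  have "indep B'" using B' sub unfolding indep_def b.basis_def b.indep_def by blast
  then have B'Z: "basis B'" using indep_card_eq_basis[OF B] assms(6) by simp
  show "Z' \<subseteq> Z"
  proof
    fix A assume A: "A \<in> Z'"
    obtain P where P: "P \<subseteq> B'" "sym_diff A P \<in> Z"
      using basis_represents[OF B'Z b.Z_subset[OF A]] by blast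
    \<comment> \<open>The remainder \<open>P\<close> is a member of \<open>Z'\<close> inside a basis
      for \<open>Z'\<close>, hence empty.\<close>
    have "sym_diff A (sym_diff A P) \<in> Z'" using b.sym_diff_Z A P sub by blast
    moreover have "sym_diff A (sym_diff A P) = P" by blast
    ultimately have "P = {}" using B' P(1) unfolding b.basis_def b.indep_def by metis
    then show "A \<in> Z" using P(2) by simp
  qed
qed (rule sub)

subsection \<open>The cycle space of a graph\<close>

text \<open>The boundary of \<open>A\<close> as a chain over the field with two elements;
  \<open>cycle_space\<close> is its kernel.\<close>

definition odd_vertices :: "('v, 'e) graph \<Rightarrow> 'e set \<Rightarrow> 'v set" where
  "odd_vertices G A = {v. odd (card {e \<in> A. v \<in> end_vertices G e})}"

definition cycle_space :: "('v, 'e) graph \<Rightarrow> 'e set set" where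
  "cycle_space G = {A. A \<subseteq> edge_set G \<and> odd_vertices G A = {}}"

text \<open>Linearity of the boundary. Edge sets are shown to be even below by adding the boundaries
  of known pieces.\<close>

lemma odd_vertices_sym_diff:
  assumes "finite A" "finite B"
  shows "odd_vertices G (sym_diff A B) = sym_diff (odd_vertices G A) (odd_vertices G B)"
proof -
  have "{e \<in> sym_diff A B. v \<in> end_vertices G e} =
      sym_diff {e \<in> A. v \<in> end_vertices G e} {e \<in> B. v \<in> end_vertices G e}" for v by blast
  then show ?thesis unfolding odd_vertices_def
    using odd_card_sym_diff[of "{e \<in> A. _ \<in> end_vertices G e}" "{e \<in> B. _ \<in> end_vertices G e}"]
      assms by auto
qed

lemma odd_vertices_empty [simp]: "odd_vertices G {} = {}"
  by (simp add: odd_vertices_def)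

lemma odd_vertices_singleton [simp]: "odd_vertices G {e} = end_vertices G e"
proof -
  have "{e' \<in> {e}. v \<in> end_vertices G e'} = (if v \<in> end_vertices G e then {e} else {})" for v
    by auto
  then show ?thesis by (auto simp: odd_vertices_def)
qed

lemma odd_vertices_subset: "odd_vertices G A \<subseteq> \<Union> (end_vertices G ` A)"
proof
  fix v assume "v \<in> odd_vertices G A"
  then have "{e \<in> A. v \<in> end_vertices G e} \<noteq> {}"
    unfolding odd_vertices_def by (metis (mono_tags) card.empty even_zero mem_Collect_eq)
  then show "v \<in> \<Union> (end_vertices G ` A)" by blast
qed

lemma binary_space_cycle_space:
  assumes "is_graph G"
  shows "binary_space (edge_set G) (cycle_space G)"
proof
  show fin: "finite (edge_set G)" using assms unfolding is_graph_def by blast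
  show "{} \<in> cycle_space G" by (simp add: cycle_space_def)
  fix C D assume "C \<in> cycle_space G" "D \<in> cycle_space G"
  then have CD: "C \<subseteq> edge_set G" "D \<subseteq> edge_set G" "odd_vertices G C = {}" "odd_vertices G D = {}"
    unfolding cycle_space_def by simp_all
  then have "odd_vertices G (sym_diff C D) = {}"
    using odd_vertices_sym_diff[of C D G] finite_subset[OF _ fin] by simp
  then show "sym_diff C D \<in> cycle_space G" using CD unfolding cycle_space_def by blast
qed (simp add: cycle_space_def)

lemma is_graph_ends:
  assumes "is_graph G" "e \<in> edge_set G" "u \<in> end_vertices G e"
  obtains v where "end_vertices G e = {u, v}" "u \<noteq> v" "u \<in> vertex_set G" "v \<in> vertex_set G"
proof -
  have "card (end_vertices G e) = 2" "end_vertices G e \<subseteq> vertex_set G"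
    using assms unfolding is_graph_def by blast+
  moreover from this obtain a b where "end_vertices G e = {a, b}" "a \<noteq> b" by (metis card_2_iff)
  ultimately show ?thesis using that[of a] that[of b] assms(3) by auto
qed

lemma is_cycle_in_cycle_space:
  assumes G: "is_graph G" and cyc: "is_cycle G vs es"
  shows "set es \<in> cycle_space G"
proof -
  let ?k = "length es"
  have k: "?k \<ge> 2" and len: "length vs = ?k" and dv: "distinct vs" and de: "distinct es"
    and sub: "set es \<subseteq> edge_set G"
    and ends: "\<And>i. i < ?k \<Longrightarrow> end_vertices G (es ! i) = {vs ! i, vs ! (Suc i mod ?k)}"
    using cyc unfolding is_cycle_def by auto
  \<comment> \<open>The boundary of an initial segment telescopes to its first and last vertex.
    Reducing the index modulo the length makes the whole list end where it starts, which gives the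
    empty boundary.\<close>
  have pre: "odd_vertices G (set (take i es)) = sym_diff {vs ! 0} {vs ! (i mod ?k)}" if "i \<le> ?k" for i
    using that
  proof (induction i)
    case 0
    then show ?case by simp
  next
    case (Suc i)
    then have i: "i < ?k" by simp
    have "es ! i \<notin> set (take i es)"
      using de i by (metis distinct_conv_nth in_set_conv_nth length_take min.absorb4 nth_take
          order.irrefl order_less_trans)
    then have "set (take (Suc i) es) = sym_diff (set (take i es)) {es ! i}"
      using i by (auto simp: take_Suc_conv_app_nth)
    then have eq: "odd_vertices G (set (take (Suc i) es)) =
        sym_diff (sym_diff {vs ! 0} {vs ! (i mod ?k)}) {vs ! i, vs ! (Suc i mod ?k)}"
      using Suc i ends[OF i] odd_vertices_sym_diff[of "set (take i es)" "{es ! i}" G] by simp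
    have "vs ! i \<noteq> vs ! (Suc i mod ?k)"
      using ends[OF i] G sub i unfolding is_graph_def
      by (metis card_2_iff doubleton_eq_iff insert_absorb2 nth_mem singletonD singleton_insert_inj_eq subsetD)
    then show ?case unfolding eq using i by auto
  qed
  have "odd_vertices G (set es) = {}" using pre[of ?k] by simp
  then show ?thesis using sub unfolding cycle_space_def by blast
qed

section \<open>Cycles inside even sets of edges\<close>

definition path_in :: "('v, 'e) graph \<Rightarrow> 'e set \<Rightarrow> 'v list \<Rightarrow> 'e list \<Rightarrow> bool" where
  "path_in G Z vs es \<longleftrightarrow> length vs = Suc (length es) \<and> distinct vs \<and> set vs \<subseteq> vertex_set G \<and>
     set es \<subseteq> Z \<and> (\<forall>i<length es. end_vertices G (es ! i) = {vs ! i, vs ! Suc i})"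

text \<open>Take a longest path with edges in \<open>Z\<close>. Its first vertex has positive even
  degree in \<open>Z\<close>, so a second edge \<open>f\<close> of \<open>Z\<close> leaves it; by
  maximality \<open>f\<close> returns to the path and closes a cycle.\<close>

lemma cycle_of_even_set:
  assumes G: "is_graph G" and Z: "Z \<in> cycle_space G" "Z \<noteq> {}"
  obtains vs es where "is_cycle G vs es" "set es \<subseteq> Z"
proof -
  have ZE: "Z \<subseteq> edge_set G" using Z unfolding cycle_space_def by blast
  have finV: "finite (vertex_set G)" and finZ: "finite Z"
    using G ZE finite_subset unfolding is_graph_def by blast+
  obtain e0 where e0: "e0 \<in> Z" using Z by blast
  then obtain a b where ab: "end_vertices G e0 = {a, b}" "a \<noteq> b" "{a, b} \<subseteq> vertex_set G"
    using G ZE unfolding is_graph_def by (metis card_2_iff subsetD)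
  let ?P = "\<lambda>k. \<exists>vs es. path_in G Z vs es \<and> length es = k"
  have P1: "?P 1" using ab e0 unfolding path_in_def
    by (intro exI[of _ "[a, b]"] exI[of _ "[e0]"]) auto
  moreover have "k \<le> card (vertex_set G)" if "?P k" for k
  proof -
    from that obtain vs es where p: "path_in G Z vs es" "length es = k" by blast
    then have "card (set vs) \<le> card (vertex_set G)"
      unfolding path_in_def using finV by (meson card_mono)
    then show "k \<le> card (vertex_set G)" using p distinct_card[of vs]
      unfolding path_in_def by simp
  qed
  ultimately obtain k where k: "?P k" "\<And>j. ?P j \<Longrightarrow> j \<le> k"
    by (rule bounded_Max_nat[where P = ?P]) (simp_all only:)
  then have k1: "k \<ge> 1" using k(2)[OF P1] by simp
  from k(1) obtain vs es where p: "path_in G Z vs es" "length es = k" by blast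
  then have len: "length vs = Suc k" and dv: "distinct vs" and vsV: "set vs \<subseteq> vertex_set G"
    and esZ: "set es \<subseteq> Z"
    and ends: "\<And>i. i < k \<Longrightarrow> end_vertices G (es ! i) = {vs ! i, vs ! Suc i}"
    unfolding path_in_def by auto
  let ?w = "vs ! 0"
  have wV: "?w \<in> vertex_set G" using vsV len by (metis nth_mem subsetD zero_less_Suc)
  let ?S = "{e \<in> Z. ?w \<in> end_vertices G e}"
  have e: "es ! 0 \<in> ?S" using ends[of 0] k1 p(2) subsetD[OF esZ nth_mem[of 0 es]] by auto
  have "even (card ?S)" using Z unfolding cycle_space_def odd_vertices_def by blast
  moreover have "card ?S \<noteq> 0" using e finZ by auto
  ultimately have "card ?S \<noteq> 1" by auto
  then have "?S \<noteq> {es ! 0}" by auto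
  then obtain f where f: "f \<in> Z" "?w \<in> end_vertices G f" "f \<noteq> es ! 0" using e by blast
  obtain u where u: "end_vertices G f = {?w, u}" "?w \<noteq> u" "u \<in> vertex_set G"
    using is_graph_ends[OF G _ f(2)] f(1) ZE by blast
  have "u \<in> set vs"
  proof (rule ccontr)
    assume nu: "u \<notin> set vs"
    have "path_in G Z (u # vs) (f # es)" unfolding path_in_def
    proof (intro conjI allI impI)
      fix i assume "i < length (f # es)"
      then show "end_vertices G ((f # es) ! i) = {(u # vs) ! i, (u # vs) ! Suc i}"
        using ends u p(2) by (cases i) auto
    qed (use len dv vsV esZ f u nu p(2) in auto)
    then have "?P (Suc k)" using p(2) by (metis length_Cons)
    then show False using k(2) by fastforce
  qed
  then obtain i where i: "i < Suc k" "vs ! i = u" using len by (metis in_set_conv_nth)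
  have i0: "i > 0" using i u(2) by (cases i) auto
  have vinj: "vs ! a = vs ! b \<longleftrightarrow> a = b" if "a \<le> k" "b \<le> k" for a b
    using nth_eq_iff_index_eq[OF dv] that len by simp
  \<comment> \<open>The first \<open>i\<close> edges of the path lead from \<open>?w\<close> to
    \<open>u\<close>, and \<open>f\<close> leads back.\<close>
  let ?vs = "take (Suc i) vs" and ?es = "take i es @ [f]"
  have fne: "f \<notin> set es"
  proof
    assume "f \<in> set es"
    then obtain j where j: "j < k" "f = es ! j" using p(2) by (metis in_set_conv_nth)
    then have "?w \<in> {vs ! j, vs ! Suc j}" using ends[OF j(1)] f(2) by auto
    then have "j = 0" using vinj[of 0 j] vinj[of 0 "Suc j"] j by auto
    then show False using f(3) j by simp
  qed
  \<comment> \<open>Equal edges at positions \<open>a\<close> and \<open>b\<close> have equal ends,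
    so either \<open>a = b\<close> or each index is the successor of the other.\<close>
  have des: "distinct es"
    unfolding distinct_conv_nth
  proof (intro allI impI)
    fix a b assume ab: "a < length es" "b < length es" "a \<noteq> b"
    show "es ! a \<noteq> es ! b"
    proof
      assume "es ! a = es ! b"
      then have "{vs ! a, vs ! Suc a} = {vs ! b, vs ! Suc b}" using ends ab p(2) by metis
      then have "a = b \<or> (a = Suc b \<and> Suc a = b)"
        using vinj ab p(2) unfolding doubleton_eq_iff by auto
      then show False using ab by auto
    qed
  qed
  have "is_cycle G ?vs ?es" unfolding is_cycle_def
  proof (intro conjI allI impI)
    have li: "length (take i es) = i" using i p(2) by simp
    show "2 \<le> length ?es" using i0 li by simp
    show "length ?vs = length ?es" using len i li by simp
    show "distinct ?vs" using dv by simp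
    show "distinct ?es" using des fne by (auto dest: in_set_takeD)
    show "set ?vs \<subseteq> vertex_set G" using vsV by (meson set_take_subset subset_trans)
    show "set ?es \<subseteq> edge_set G" using esZ f(1) ZE by (auto dest: in_set_takeD)
    fix j assume "j < length ?es"
    then have "j \<le> i" using li by simp
    show "end_vertices G (?es ! j) = {?vs ! j, ?vs ! (Suc j mod length ?es)}"
    proof (cases "j = i")
      case True
      then show ?thesis using u i li by (simp add: nth_append insert_commute)
    next
      case False
      then show ?thesis using ends[of j] i \<open>j \<le> i\<close> li by (simp add: nth_append)
    qed
  qed
  moreover have "set ?es \<subseteq> Z" using esZ f(1) by (auto dest: in_set_takeD)
  ultimately show ?thesis using that by blast
qed

text \<open>A cycle is a nonempty member of the cycle space, and by \<open>cycle_of_even_set\<close>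
  every nonempty member contains a cycle.\<close>

lemma forest_edges_iff_indep:
  assumes "is_graph G"
  shows "forest_edges G A \<longleftrightarrow> binary_space.indep (edge_set G) (cycle_space G) A"
proof -
  have "(\<exists>vs es. is_cycle G vs es \<and> set es \<subseteq> A) \<longleftrightarrow> (\<exists>C\<in>cycle_space G. C \<subseteq> A \<and> C \<noteq> {})"
  proof
    assume "\<exists>vs es. is_cycle G vs es \<and> set es \<subseteq> A"
    then obtain vs es where c: "is_cycle G vs es" "set es \<subseteq> A" by blast
    moreover have "set es \<noteq> {}" using c(1) unfolding is_cycle_def by auto
    ultimately show "\<exists>C\<in>cycle_space G. C \<subseteq> A \<and> C \<noteq> {}"
      using is_cycle_in_cycle_space[OF assms c(1)] by blast
  next
    assume "\<exists>C\<in>cycle_space G. C \<subseteq> A \<and> C \<noteq> {}"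
    then obtain C where C: "C \<in> cycle_space G" "C \<noteq> {}" and "C \<subseteq> A" by blast
    then show "\<exists>vs es. is_cycle G vs es \<and> set es \<subseteq> A"
      using cycle_of_even_set[OF assms C] by (metis subset_trans)
  qed
  then show ?thesis unfolding forest_edges_def
      binary_space.indep_def[OF binary_space_cycle_space[OF assms]] by simp
qed

lemma maximal_forest_edges_iff_basis:
  assumes "is_graph G"
  shows "maximal_forest_edges G A \<longleftrightarrow> binary_space.basis (edge_set G) (cycle_space G) A"
  unfolding maximal_forest_edges_def binary_space.basis_def[OF binary_space_cycle_space[OF assms]]
  by (simp only: forest_edges_iff_indep[OF assms])

subsection \<open>Paths, degrees and ranks\<close>

definition edge_relation :: "('v, 'e) graph \<Rightarrow> 'e set \<Rightarrow> ('v \<times> 'v) set" where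
  "edge_relation G A = {(u, v). \<exists>e\<in>A. end_vertices G e = {u, v}}"

text \<open>The edges of a walk are counted modulo two, so the boundary telescopes and no simple
  path has to be extracted. Writing the boundary as a symmetric difference covers
  \<open>a = b\<close>.\<close>

lemma edge_relation_path:
  assumes "finite A" "(a, b) \<in> (edge_relation G A)\<^sup>*"
  obtains P where "P \<subseteq> A" "odd_vertices G P = sym_diff {a} {b}"
proof -
  from assms(2) have "\<exists>P\<subseteq>A. odd_vertices G P = sym_diff {a} {b}"
  proof (induction rule: rtrancl_induct)
    case base
    then show ?case by (intro exI[of _ "{}"]) simp
  next
    case (step y z)
    then obtain P e where P: "P \<subseteq> A" "odd_vertices G P = sym_diff {a} {y}"
      and e: "e \<in> A" "end_vertices G e = {y, z}"
      unfolding edge_relation_def by blast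
    show ?case
    \<comment> \<open>Nothing here forces an edge to have two distinct ends; a step with
      \<open>y = z\<close> is skipped.\<close>
    proof (cases "y = z")
      case True
      then show ?thesis using P by blast
    next
      case False
      have "odd_vertices G (sym_diff P {e}) = sym_diff (sym_diff {a} {y}) {y, z}"
        using odd_vertices_sym_diff[of P "{e}" G] P e finite_subset[OF P(1) assms(1)] by simp
      also have "\<dots> = sym_diff {a} {z}" using False by blast
      finally have "odd_vertices G (sym_diff P {e}) = sym_diff {a} {z}" .
      moreover have "sym_diff P {e} \<subseteq> A" using P e by blast
      ultimately show ?thesis by blast
    qed
  qed
  then show ?thesis using that by blast
qed

section \<open>Walks, neighbours and degrees in 3-connected graphs\<close>

lemma adjacency_delete_vertices:
  "adjacency (delete_vertices G X) = edge_relation G {e \<in> edge_set G. end_vertices G e \<inter> X = {}}"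
  unfolding adjacency_def delete_vertices_def edge_relation_def by simp

lemma three_connected_reachable:
  assumes "three_connected G" "X \<subseteq> vertex_set G" "card X < 3"
    and "a \<in> vertex_set G - X" "b \<in> vertex_set G - X"
  shows "(a, b) \<in> (edge_relation G {e \<in> edge_set G. end_vertices G e \<inter> X = {}})\<^sup>*"
proof -
  have "connected_graph (delete_vertices G X)"
    using assms(1-3) unfolding three_connected_def by blast
  then have "(a, b) \<in> (adjacency (delete_vertices G X))\<^sup>*"
    using assms(4,5) unfolding connected_graph_def by (simp add: delete_vertices_def)
  then show ?thesis unfolding adjacency_delete_vertices .
qed

lemma three_connected_path:
  assumes "is_graph G" "three_connected G" "X \<subseteq> vertex_set G" "card X < 3"
    and "a \<in> vertex_set G - X" "b \<in> vertex_set G - X"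
  obtains P where "P \<subseteq> edge_set G" "\<And>e. e \<in> P \<Longrightarrow> end_vertices G e \<inter> X = {}"
    "odd_vertices G P = sym_diff {a} {b}"
proof -
  let ?A = "{e \<in> edge_set G. end_vertices G e \<inter> X = {}}"
  have "finite ?A" using assms(1) unfolding is_graph_def by simp
  then obtain P where "P \<subseteq> ?A" "odd_vertices G P = sym_diff {a} {b}"
    using edge_relation_path[OF _ three_connected_reachable[OF assms(2-6)]] by blast
  then have "P \<subseteq> edge_set G" "\<forall>e\<in>P. end_vertices G e \<inter> X = {}" by blast+
  then show ?thesis using that[of P] \<open>odd_vertices G P = _\<close> by simp
qed

text \<open>The first edge of a walk from \<open>a\<close> to \<open>b\<close> avoiding
  \<open>X\<close> is as wanted; \<open>b\<close> witnesses that the walk is not trivial.\<close>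

lemma three_connected_neighbour:
  assumes "is_graph G" "three_connected G" "X \<subseteq> vertex_set G" "card X < 3"
    and "a \<in> vertex_set G - X" "b \<in> vertex_set G - X" "a \<noteq> b"
  obtains e y where "e \<in> edge_set G" "end_vertices G e = {a, y}" "y \<noteq> a" "y \<in> vertex_set G - X"
proof -
  from three_connected_reachable[OF assms(2-6)]
  obtain z where "(a, z) \<in> edge_relation G {e \<in> edge_set G. end_vertices G e \<inter> X = {}}"
    using assms(7) by (metis converse_rtranclE)
  then obtain e where e: "e \<in> edge_set G" "end_vertices G e \<inter> X = {}" "end_vertices G e = {a, z}"
    unfolding edge_relation_def by blast
  moreover have "z \<noteq> a \<and> z \<in> vertex_set G"
    using assms(1) e unfolding is_graph_def by (auto simp: card_2_iff)
  ultimately show ?thesis using that[of e z] by auto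
qed

text \<open>With at most two edges at \<open>v\<close>, the set \<open>X\<close> of its neighbours
  has at most two elements. Some vertex lies outside \<open>insert v X\<close>, yet deleting
  \<open>X\<close> isolates \<open>v\<close>.\<close>

lemma three_connected_degree:
  assumes G: "is_graph G" and con: "three_connected G" and v: "v \<in> vertex_set G"
  shows "3 \<le> card (vertex_star G v)"
proof (rule ccontr)
  assume "\<not> ?thesis"
  let ?S = "vertex_star G v"
  define X where "X = (\<Union>e\<in>?S. end_vertices G e - {v})"
  have fin: "finite ?S" "finite (vertex_set G)"
    using G unfolding is_graph_def vertex_star_def by simp_all
  have "card (end_vertices G e - {v}) = 1" if "e \<in> ?S" for e
    using that G unfolding is_graph_def vertex_star_def by (auto simp: card_2_iff)
  then have "(\<Sum>e\<in>?S. card (end_vertices G e - {v})) = card ?S" by simp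
  moreover have "card X \<le> (\<Sum>e\<in>?S. card (end_vertices G e - {v}))"
    unfolding X_def using fin(1) by (rule card_UN_le)
  ultimately have cX: "card X < 3" using \<open>\<not> 3 \<le> card ?S\<close> by simp
  have XV: "X \<subseteq> vertex_set G" and vX: "v \<notin> X"
    using G unfolding X_def is_graph_def vertex_star_def by auto
  have "card (insert v X) < card (vertex_set G)"
    using cX con card_insert_le_m1[of 3 X v] unfolding three_connected_def by simp
  moreover have "finite (insert v X)" using XV fin(2) finite_subset by simp
  ultimately have "\<not> vertex_set G \<subseteq> insert v X" using card_mono leD by blast
  then obtain w where w: "w \<in> vertex_set G" "w \<notin> insert v X" by blast
  obtain e y where ey: "e \<in> edge_set G" "end_vertices G e = {v, y}" "y \<noteq> v" "y \<in> vertex_set G - X"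
    by (rule three_connected_neighbour[OF G con XV cX, of v w]) (use v vX w in auto)
  then show False unfolding X_def vertex_star_def by auto
qed

text \<open>On four vertices, deleting the two vertices outside a given pair must leave a connected
  graph, so every pair is adjacent. Without parallel edges the graph is then K4.\<close>

lemma three_connected_card_ge_5:
  assumes "admissible_graph G" and con: "three_connected G"
    and niso: "\<not> isomorphic_graphs G (complete_graph 4)"
  shows "5 \<le> card (vertex_set G)"
proof (rule ccontr)
  assume "\<not> ?thesis"
  then have four: "card (vertex_set G) = 4" using con unfolding three_connected_def by simp
  have G: "is_graph G" and inj: "inj_on (end_vertices G) (edge_set G)"
    using assms(1) unfolding admissible_graph_def no_parallel_edges_def by blast+
  have fin: "finite (vertex_set G)" using G unfolding is_graph_def by blast
  obtain f where f: "bij_betw f (vertex_set G) {..<4::nat}"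
    using finite_same_card_bij[OF fin, of "{..<4::nat}"] four by auto
  let ?g = "\<lambda>e. f ` end_vertices G e"
  have finj: "inj_on f (vertex_set G)" and fim: "f ` vertex_set G = {..<4}"
    using f unfolding bij_betw_def by blast+
  have ends: "end_vertices G e \<subseteq> vertex_set G" "card (end_vertices G e) = 2" if "e \<in> edge_set G" for e
    using G that unfolding is_graph_def by blast+
  have "bij_betw ?g (edge_set G) {e. e \<subseteq> {..<4} \<and> card e = 2}"
    unfolding bij_betw_def
  proof (intro conjI subset_antisym subsetI)
    show "inj_on ?g (edge_set G)"
    proof (rule inj_onI)
      fix e e' assume "e \<in> edge_set G" "e' \<in> edge_set G" "?g e = ?g e'"
      then show "e = e'"
        using inj_on_image_eq_iff[OF finj ends(1) ends(1)] inj by (metis inj_onD)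
    qed
    fix S assume "S \<in> ?g ` edge_set G"
    then obtain e where e: "e \<in> edge_set G" "S = ?g e" by blast
    then have "card S = 2" using card_image[OF inj_on_subset[OF finj ends(1)]] ends(2) by simp
    moreover have "S \<subseteq> {..<4}" using e ends(1) fim by blast
    ultimately show "S \<in> {e. e \<subseteq> {..<4} \<and> card e = 2}" by blast
  next
    fix S :: "nat set" assume "S \<in> {e. e \<subseteq> {..<4} \<and> card e = 2}"
    then have S: "S \<subseteq> f ` vertex_set G" "card S = 2" using fim by auto
    then obtain c d where cd: "S = {c, d}" "c \<noteq> d" unfolding card_2_iff by blast
    then obtain a b where "c = f a" "d = f b" "a \<in> vertex_set G" "b \<in> vertex_set G"
      using S(1) by blast
    then have ab: "S = {f a, f b}" "a \<in> vertex_set G" "b \<in> vertex_set G" "a \<noteq> b"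
      using cd by auto
    let ?X = "vertex_set G - {a, b}"
    have "card ?X < 3" using ab four by (simp add: card_Diff_subset)
    then obtain e y where "e \<in> edge_set G" "end_vertices G e = {a, y}" "y \<noteq> a" "y \<in> vertex_set G - ?X"
      using three_connected_neighbour[OF G con, of ?X a b] ab by auto
    then have "e \<in> edge_set G" "?g e = S" using ab by auto
    then show "S \<in> ?g ` edge_set G" by blast
  qed
  then have "isomorphic_graphs G (complete_graph 4)"
    unfolding isomorphic_graphs_def complete_graph_def
    using f by (intro exI[of _ f] exI[of _ ?g]) simp
  then show False using niso by blast
qed

section \<open>Ranks of forests and of connected graphs\<close>

lemma even_card_odd_vertices:
  assumes G: "is_graph G" and "A \<subseteq> edge_set G"
  shows "even (card (odd_vertices G A))"
proof -
  have fin: "finite (vertex_set G)" and "finite A"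
    using G assms(2) finite_subset unfolding is_graph_def by blast+
  from \<open>finite A\<close> assms(2) show ?thesis
  proof (induction A)
    case empty
    then show ?case by simp
  next
    case (insert e A)
    have e: "card (end_vertices G e) = 2" "end_vertices G e \<subseteq> vertex_set G"
      using insert.prems G unfolding is_graph_def by blast+
    have "odd_vertices G A \<subseteq> vertex_set G"
      using odd_vertices_subset[of G A] insert.prems G unfolding is_graph_def by blast
    then have "finite (odd_vertices G A)" using fin finite_subset by blast
    moreover have "finite (end_vertices G e)" using e(2) fin finite_subset by blast
    moreover have "insert e A = sym_diff A {e}" using insert.hyps by blast
    ultimately show ?case
      using odd_vertices_sym_diff[of A "{e}" G] odd_card_sym_diff[of "odd_vertices G A" "end_vertices G e"]
        insert e by simp
  qed
qed

text \<open>The odd vertices embed the subsets of a forest \<open>A\<close> into the even sets of vertices.\<close>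

lemma indep_card_less:
  assumes G: "is_graph G" and A: "binary_space.indep (edge_set G) (cycle_space G) A" "A \<noteq> {}"
  shows "card A < card (\<Union> (end_vertices G ` A))"
proof -
  interpret binary_space "edge_set G" "cycle_space G" by (rule binary_space_cycle_space[OF G])
  let ?U = "\<Union> (end_vertices G ` A)"
  have AE: "A \<subseteq> edge_set G" using A(1) unfolding indep_def by blast
  have finA: "finite A" using indep_finite[OF A(1)] .
  have "?U \<subseteq> vertex_set G" "finite (vertex_set G)" using AE G unfolding is_graph_def by blast+
  then have finU: "finite ?U" using finite_subset by blast
  obtain e where e: "e \<in> A" using A(2) by blast
  then have "end_vertices G e \<noteq> {}" using AE G unfolding is_graph_def by fastforce
  then obtain x where x: "x \<in> ?U" using e by blast
  have inj: "inj_on (odd_vertices G) (Pow A)"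
  proof (rule inj_onI)
    fix P Q assume PQ: "P \<in> Pow A" "Q \<in> Pow A" "odd_vertices G P = odd_vertices G Q"
    then have "finite P" "finite Q" using finA finite_subset by blast+
    then have "odd_vertices G (sym_diff P Q) = {}" using odd_vertices_sym_diff[of P Q G] PQ by simp
    moreover have "sym_diff P Q \<subseteq> A" using PQ by blast
    ultimately have "sym_diff P Q \<in> cycle_space G" using AE unfolding cycle_space_def by blast
    then have "sym_diff P Q = {}" using A(1) \<open>sym_diff P Q \<subseteq> A\<close> unfolding indep_def by blast
    then show "P = Q" by blast
  qed
  \<comment> \<open>A boundary has even size, so the singleton \<open>{x}\<close> is missed; this
    makes the count of subsets strict.\<close>
  have "odd_vertices G ` Pow A \<subseteq> Pow ?U - {{x}}"
  proof
    fix S assume "S \<in> odd_vertices G ` Pow A"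
    then obtain P where P: "P \<subseteq> A" "S = odd_vertices G P" by blast
    then have PE: "P \<subseteq> edge_set G" using AE by blast
    have "S \<subseteq> ?U" using odd_vertices_subset[of G P] P by blast
    moreover have "even (card S)" using even_card_odd_vertices[OF G PE] P by simp
    ultimately show "S \<in> Pow ?U - {{x}}" by auto
  qed
  then have "card (Pow A) \<le> card (Pow ?U - {{x}})"
    using inj finU by (intro card_inj_on_le) auto
  also have "\<dots> < card (Pow ?U)" using x finU by (intro psubset_card_mono) auto
  finally have "(2::nat) ^ card A < 2 ^ card ?U" using finA finU by (simp add: card_Pow)
  then show ?thesis by simp
qed

text \<open>Connectedness makes every set of vertices other than a root \<open>r\<close> a boundary
  up to \<open>r\<close>, already of a subset of \<open>B\<close>. Hence \<open>B\<close> has at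
  least as many subsets as the vertex set without \<open>r\<close>.\<close>

lemma connected_basis_card:
  assumes G: "is_graph G" and con: "connected_graph G"
    and B: "binary_space.basis (edge_set G) (cycle_space G) B"
  shows "card (vertex_set G) \<le> Suc (card B)"
proof -
  interpret binary_space "edge_set G" "cycle_space G" by (rule binary_space_cycle_space[OF G])
  have fin: "finite (vertex_set G)" "finite (edge_set G)" using G unfolding is_graph_def by blast+
  obtain r where r: "r \<in> vertex_set G" using G unfolding is_graph_def by blast
  have BE: "B \<subseteq> edge_set G" using B unfolding basis_def indep_def by blast
  then have finB: "finite B" using fin finite_subset by blast
  \<comment> \<open>A walk from \<open>r\<close> to \<open>v\<close> is replaced by a subset of
    \<open>B\<close> congruent to it modulo the cycle space, which leaves the boundary
    unchanged.\<close>
  have one: "\<exists>P\<subseteq>B. odd_vertices G P = {r, v}" if v: "v \<in> vertex_set G - {r}" for v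
  proof -
    have "(r, v) \<in> (edge_relation G (edge_set G))\<^sup>*"
      using con r v unfolding connected_graph_def adjacency_def edge_relation_def by blast
    then obtain P where P: "P \<subseteq> edge_set G" "odd_vertices G P = sym_diff {r} {v}"
      by (rule edge_relation_path[OF fin(2)])
    obtain Q where Q: "Q \<subseteq> B" "sym_diff P Q \<in> cycle_space G" by (rule basis_represents[OF B P(1)])
    have "finite P" by (rule finite_subset[OF P(1) fin(2)])
    moreover have "finite Q" by (rule finite_subset[OF Q(1) finB])
    ultimately have "sym_diff (odd_vertices G P) (odd_vertices G Q) = {}"
      using Q(2) odd_vertices_sym_diff[of P Q G] unfolding cycle_space_def by simp
    then have "odd_vertices G Q = odd_vertices G P" by blast
    also have "\<dots> = {r, v}" using P v by blast
    finally show ?thesis using Q by blast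
  qed
  have "\<exists>P\<subseteq>B. odd_vertices G P - {r} = U" if "U \<subseteq> vertex_set G - {r}" for U
  proof -
    have "finite U" using that fin finite_subset by blast
    then show ?thesis using that
    proof (induction U)
      case empty
      then show ?case by (intro exI[of _ "{}"]) simp
    next
      case (insert v U)
      then obtain P where P: "P \<subseteq> B" "odd_vertices G P - {r} = U" by auto
      have v: "v \<in> vertex_set G - {r}" using insert.prems by blast
      obtain Q where Q: "Q \<subseteq> B" "odd_vertices G Q = {r, v}" using one[OF v] by blast
      have "finite P" by (rule finite_subset[OF P(1) finB])
      moreover have "finite Q" by (rule finite_subset[OF Q(1) finB])
      ultimately have "odd_vertices G (sym_diff P Q) = sym_diff (odd_vertices G P) {r, v}"
        using odd_vertices_sym_diff[of P Q G] Q by simp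
      then have "odd_vertices G (sym_diff P Q) - {r} = insert v U"
        using P(2) insert.hyps(2) v by auto
      moreover have "sym_diff P Q \<subseteq> B" using P Q by blast
      ultimately show ?case by blast
    qed
  qed
  then have "Pow (vertex_set G - {r}) \<subseteq> (\<lambda>P. odd_vertices G P - {r}) ` Pow B"
    by (metis (no_types, lifting) PowD PowI image_eqI subsetI)
  then have "card (Pow (vertex_set G - {r})) \<le> card (Pow B)"
    using finB by (intro surj_card_le) auto
  then have "(2::nat) ^ card (vertex_set G - {r}) \<le> 2 ^ card B"
    using finB fin by (simp add: card_Pow)
  then have "card (vertex_set G - {r}) \<le> card B" by simp
  then show ?thesis using r fin by (simp add: card_Diff_singleton)
qed

lemma three_connected_imp_connected:
  assumes "three_connected G"
  shows "connected_graph G"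
proof -
  have "connected_graph (delete_vertices G {})"
    using assms unfolding three_connected_def by simp
  then show ?thesis unfolding connected_graph_def adjacency_def by (simp add: delete_vertices_def)
qed

subsection \<open>Short circuits generate the cycle space\<close>

definition circuit :: "('v, 'e) graph \<Rightarrow> 'e set \<Rightarrow> bool" where
  "circuit G C \<longleftrightarrow> C \<in> cycle_space G \<and> C \<noteq> {} \<and> (\<forall>D\<in>cycle_space G. D \<subseteq> C \<longrightarrow> D = {} \<or> D = C)"

lemma reachable_edge_ends:
  assumes G: "is_graph G" and "A \<subseteq> edge_set G" and e: "e \<in> A"
    and x: "x \<in> end_vertices G e" "(a, x) \<in> (edge_relation G A)\<^sup>*" and y: "y \<in> end_vertices G e"
  shows "(a, y) \<in> (edge_relation G A)\<^sup>*"
proof (cases "x = y")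
  case False
  have "e \<in> edge_set G" using assms by blast
  then obtain z where "end_vertices G e = {x, z}" by (rule is_graph_ends[OF G _ x(1)])
  then have "end_vertices G e = {x, y}" using y False by auto
  then have "(x, y) \<in> edge_relation G A" using e unfolding edge_relation_def by blast
  with x(2) show ?thesis by (rule rtrancl_into_rtrancl)
qed (use x in simp)

text \<open>The edges of \<open>C\<close> in the component of \<open>a\<close> contain at each
  vertex all the edges of \<open>C\<close> or none, so they form an even set. Minimality of
  \<open>C\<close> makes this set all of \<open>C\<close>.\<close>

lemma circuit_path:
  assumes G: "is_graph G" and C: "circuit G C"
    and a: "a \<in> \<Union> (end_vertices G ` C)" and b: "b \<in> \<Union> (end_vertices G ` C)"
  obtains P where "P \<subseteq> C" "odd_vertices G P = sym_diff {a} {b}"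
proof -
  have CE: "C \<subseteq> edge_set G" and C0: "odd_vertices G C = {}"
    using C unfolding circuit_def cycle_space_def by blast+
  have finC: "finite C" using CE G finite_subset unfolding is_graph_def by blast
  define X where "X = {e \<in> C. \<exists>x\<in>end_vertices G e. (a, x) \<in> (edge_relation G C)\<^sup>*}"
  have step: "(a, y) \<in> (edge_relation G C)\<^sup>*" if e: "e \<in> X" "y \<in> end_vertices G e" for e y
    using e reachable_edge_ends[OF G CE] unfolding X_def by blast
  have star: "{e \<in> X. v \<in> end_vertices G e} =
      (if (a, v) \<in> (edge_relation G C)\<^sup>* then {e \<in> C. v \<in> end_vertices G e} else {})" for v
    using step unfolding X_def by auto
  have "odd_vertices G X = {}"
    unfolding odd_vertices_def star using C0 unfolding odd_vertices_def by auto
  then have "X \<in> cycle_space G" using CE unfolding cycle_space_def X_def by blast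
  moreover have "X \<subseteq> C" unfolding X_def by blast
  moreover have "X \<noteq> {}" using a unfolding X_def by blast
  ultimately have "X = C" using C unfolding circuit_def by blast
  then have "(a, b) \<in> (edge_relation G C)\<^sup>*" using b step by blast
  then obtain P where "P \<subseteq> C" "odd_vertices G P = sym_diff {a} {b}"
    by (rule edge_relation_path[OF finC])
  then show ?thesis by (rule that)
qed

lemma sum_star_card:
  assumes G: "is_graph G" and "C \<subseteq> edge_set G"
  shows "(\<Sum>x\<in>\<Union> (end_vertices G ` C). card {e \<in> C. x \<in> end_vertices G e}) = 2 * card C"
proof -
  let ?U = "\<Union> (end_vertices G ` C)"
  have fin: "finite C" using assms finite_subset unfolding is_graph_def by blast
  have "?U \<subseteq> vertex_set G" "finite (vertex_set G)" using assms unfolding is_graph_def by blast+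
  then have finU: "finite ?U" by (rule finite_subset)
  have "card {x \<in> ?U. x \<in> end_vertices G e} = 2" if "e \<in> C" for e
  proof -
    have "{x \<in> ?U. x \<in> end_vertices G e} = end_vertices G e" using that by blast
    then show ?thesis using that assms unfolding is_graph_def by auto
  qed
  then show ?thesis using sum_multicount[OF finU fin, of "\<lambda>x e. x \<in> end_vertices G e" 2] by simp
qed

text \<open>The wheel case: \<open>v\<close> is the hub and \<open>s x\<close> the spoke to
  \<open>x\<close>. Every vertex of \<open>C\<close> has degree two in \<open>C\<close> but at least
  three in \<open>G\<close>, and an additional edge is no chord, so it leaves the circuit. As
  \<open>C\<close> is long, only one vertex remains outside.\<close>

lemma chordless_long_circuit:
  assumes G: "is_graph G" and con: "three_connected G"
    and C: "circuit G C" and long: "card (vertex_set G) < card C + 2" and "2 \<le> card C"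
    and chordless: "\<And>f. f \<in> edge_set G \<Longrightarrow> end_vertices G f \<subseteq> \<Union> (end_vertices G ` C) \<Longrightarrow> f \<in> C"
  obtains v s where "v \<notin> \<Union> (end_vertices G ` C)"
    "\<And>x. x \<in> \<Union> (end_vertices G ` C) \<Longrightarrow> s x \<in> edge_set G \<and> end_vertices G (s x) = {x, v}"
proof -
  interpret binary_space "edge_set G" "cycle_space G" by (rule binary_space_cycle_space[OF G])
  let ?U = "\<Union> (end_vertices G ` C)"
  let ?d = "\<lambda>x. card {e \<in> C. x \<in> end_vertices G e}"
  have CZ: "C \<in> cycle_space G" and min: "\<And>D. D \<in> cycle_space G \<Longrightarrow> D \<subseteq> C \<Longrightarrow> D = {} \<or> D = C"
    using C unfolding circuit_def by blast+
  have CE: "C \<subseteq> edge_set G" by (rule Z_subset[OF CZ])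
  have finC: "finite C" by (rule finite_subset[OF CE finite_E])
  have finV: "finite (vertex_set G)" using G unfolding is_graph_def by blast
  have UV: "?U \<subseteq> vertex_set G" using CE G unfolding is_graph_def by blast
  have finU: "finite ?U" by (rule finite_subset[OF UV finV])
  obtain e where e: "e \<in> C" using C unfolding circuit_def by blast
  \<comment> \<open>Removing one edge leaves a forest, which has fewer edges than vertices; so
    \<open>C\<close> has at most as many edges as vertices.\<close>
  have "indep (C - {e})" unfolding indep_def using CE min e by blast
  moreover have "C - {e} \<noteq> {}"
  proof
    assume "C - {e} = {}"
    then have "card C \<le> card {e}" by (intro card_mono) auto
    then show False using \<open>2 \<le> card C\<close> by simp
  qed
  ultimately have "card (C - {e}) < card (\<Union> (end_vertices G ` (C - {e})))"
    by (rule indep_card_less[OF G])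
  also have "\<dots> \<le> card ?U" using finU by (intro card_mono) auto
  finally have CU: "card C \<le> card ?U" using e finC by simp
  have d2: "2 \<le> ?d x" if "x \<in> ?U" for x
  proof -
    have "{e \<in> C. x \<in> end_vertices G e} \<noteq> {}" using that by blast
    then have "?d x \<noteq> 0" using finC by simp
    moreover have "even (?d x)" using CZ unfolding cycle_space_def odd_vertices_def by blast
    ultimately show ?thesis by presburger
  qed
  have sum: "(\<Sum>x\<in>?U. ?d x) = 2 * card C" by (rule sum_star_card[OF G CE])
  \<comment> \<open>A larger degree would push the degree sum above \<open>2 * card ?U\<close>,
    hence above \<open>2 * card C\<close>.\<close>
  have dle: "?d x \<le> 2" if "x \<in> ?U" for x
  proof (rule ccontr)
    assume "\<not> ?d x \<le> 2"
    have "(\<Sum>x\<in>?U. 2) < (\<Sum>x\<in>?U. ?d x)"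
    proof (rule sum_strict_mono_ex1)
      show "\<exists>x\<in>?U. 2 < ?d x" by (rule bexI[OF _ that]) (use \<open>\<not> ?d x \<le> 2\<close> in simp)
    qed (use d2 finU in blast)+
    then show False using sum CU by simp
  qed
  have out: "\<exists>f y. f \<in> edge_set G \<and> end_vertices G f = {x, y} \<and> y \<in> vertex_set G - ?U"
    if x: "x \<in> ?U" for x
  proof -
    have "3 \<le> card (vertex_star G x)" using three_connected_degree[OF G con] x UV by blast
    then have "\<not> vertex_star G x \<subseteq> {e \<in> C. x \<in> end_vertices G e}"
      using card_mono[of "{e \<in> C. x \<in> end_vertices G e}" "vertex_star G x"] finC dle[OF x] by auto
    then obtain f where f: "f \<in> edge_set G" "x \<in> end_vertices G f" "f \<notin> C"
      unfolding vertex_star_def by blast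
    obtain y where y: "end_vertices G f = {x, y}" "y \<in> vertex_set G"
      using is_graph_ends[OF G f(1,2)] by metis
    then have "y \<notin> ?U" using chordless[OF f(1)] f(3) x by auto
    then show ?thesis using f y by blast
  qed
  have "card (end_vertices G e) = 2" using e CE G unfolding is_graph_def by blast
  then have "end_vertices G e \<noteq> {}" by auto
  then obtain x0 where "x0 \<in> ?U" using e by blast
  then obtain v where v: "v \<in> vertex_set G - ?U" using out by blast
  have "card (vertex_set G - ?U) \<le> 1"
    using card_Diff_subset[OF finU UV] CU long by simp
  then have "vertex_set G - ?U = {v}"
    using v finV card_le_Suc0_iff_eq[of "vertex_set G - ?U"] by auto
  then have "\<forall>x\<in>?U. \<exists>f. f \<in> edge_set G \<and> end_vertices G f = {x, v}" using out by (metis singletonD)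
  then obtain s where "\<forall>x\<in>?U. s x \<in> edge_set G \<and> end_vertices G (s x) = {x, v}"
    by (rule bchoice[THEN exE])
  then show ?thesis using that[of v s] v by blast
qed

text \<open>Each rim edge forms a triangle with the two spokes at its ends. In the sum of these
  triangles the spokes cancel, since \<open>C\<close> has empty boundary.\<close>

lemma wheel_rim_in_span:
  assumes G: "is_graph G" and "binary_space E' W" and C: "C \<in> cycle_space G"
    and v: "v \<notin> \<Union> (end_vertices G ` C)"
    and s: "\<And>x. x \<in> \<Union> (end_vertices G ` C) \<Longrightarrow> s x \<in> edge_set G \<and> end_vertices G (s x) = {x, v}"
    and triangles: "\<And>D. D \<in> cycle_space G \<Longrightarrow> card D = 3 \<Longrightarrow> D \<in> W"
  shows "C \<in> W"
proof -
  interpret W: binary_space E' W by fact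
  let ?U = "\<Union> (end_vertices G ` C)"
  have CE: "C \<subseteq> edge_set G" and C0: "odd_vertices G C = {}" using C unfolding cycle_space_def by blast+
  have "finite (edge_set G)" using G unfolding is_graph_def by blast
  then have finC: "finite C" by (rule finite_subset[OF CE])
  have inj: "inj_on s ?U"
  proof (rule inj_onI)
    fix x y assume "x \<in> ?U" "y \<in> ?U" "s x = s y"
    then have "{x, v} = {y, v}" "x \<noteq> v" "y \<noteq> v" using s[of x] s[of y] v by auto
    then show "x = y" by (auto simp: doubleton_eq_iff)
  qed
  \<comment> \<open>Injectivity of \<open>s\<close> lets spokes be added modulo two in the same way
    as their vertices.\<close>
  have image: "s ` sym_diff S T = sym_diff (s ` S) (s ` T)" if "S \<subseteq> ?U" "T \<subseteq> ?U" for S T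
  proof -
    have "s ` (S - T) = s ` S - s ` T" "s ` (T - S) = s ` T - s ` S"
      using that by (intro inj_on_image_set_diff[OF inj]; blast)+
    then show ?thesis by (simp only: image_Un)
  qed
  \<comment> \<open>Invariant of the induction: the triangles over \<open>A\<close> add up to
    \<open>A\<close> and the spokes at its odd vertices. For \<open>A = C\<close> no spoke is
    left.\<close>
  have "sym_diff A (s ` odd_vertices G A) \<in> W" if "A \<subseteq> C" for A
    using finite_subset[OF that finC] that
  proof (induction A)
    case empty
    then show ?case using W.empty_Z by simp
  next
    case (insert e A)
    let ?e = "end_vertices G e"
    have e: "e \<in> C" "e \<in> edge_set G" and AC: "A \<subseteq> C" using insert.prems CE by blast+
    have "card ?e = 2" using e G unfolding is_graph_def by blast
    then obtain x y where xy: "?e = {x, y}" "x \<noteq> y" unfolding card_2_iff by blast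
    have U: "x \<in> ?U" "y \<in> ?U" using xy e by auto
    have sx: "s x \<in> edge_set G" "end_vertices G (s x) = {x, v}" using s U by blast+
    have sy: "s y \<in> edge_set G" "end_vertices G (s y) = {y, v}" using s U by blast+
    have ne: "x \<noteq> v" "y \<noteq> v" using U v by blast+
    have diff: "s x \<noteq> s y" using inj U xy(2) by (metis inj_onD)
    have en: "e \<noteq> s x" "e \<noteq> s y" using sx sy xy ne by (auto simp: doubleton_eq_iff)
    let ?T = "sym_diff {e} (sym_diff {s x} {s y})"
    have T: "?T = {e, s x, s y}" using diff en by auto
    have "odd_vertices G ?T = sym_diff {x, y} (sym_diff {x, v} {y, v})"
      using odd_vertices_sym_diff[of "{e}" "sym_diff {s x} {s y}" G]
        odd_vertices_sym_diff[of "{s x}" "{s y}" G] sx(2) sy(2) xy(1) by simp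
    also have "\<dots> = {}" using xy ne by blast
    finally have "?T \<in> cycle_space G" unfolding cycle_space_def using T e sx sy by simp
    moreover have "card ?T = 3" unfolding T using diff en by simp
    ultimately have "?T \<in> W" by (rule triangles)
    moreover have "sym_diff A (s ` odd_vertices G A) \<in> W" using insert.IH AC by blast
    ultimately have mem: "sym_diff (sym_diff A (s ` odd_vertices G A)) ?T \<in> W"
      using W.sym_diff_Z by blast
    have ins: "insert e A = sym_diff A {e}" using insert.hyps by blast
    have "odd_vertices G A \<subseteq> ?U" using odd_vertices_subset[of G A] AC CE by blast
    then have "s ` odd_vertices G (insert e A) = sym_diff (s ` odd_vertices G A) (s ` {x, y})"
      unfolding ins using odd_vertices_sym_diff[of A "{e}" G] insert.hyps(1) xy(1)
        image[of "odd_vertices G A" "{x, y}"] U by simp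
    also have "s ` {x, y} = sym_diff {s x} {s y}" using diff by auto
    finally have "sym_diff (insert e A) (s ` odd_vertices G (insert e A)) =
        sym_diff (sym_diff A {e}) (sym_diff (s ` odd_vertices G A) (sym_diff {s x} {s y}))"
      using ins by simp
    also have "\<dots> = sym_diff (sym_diff A (s ` odd_vertices G A)) ?T" by blast
    finally show ?case using mem by simp
  qed
  from this[of C] show ?thesis using C0 by simp
qed

text \<open>Induction on the size of \<open>C\<close>: a set that is not a circuit splits into
  smaller even sets, a long circuit with a chord splits along it, and one without a chord is the rim
  of a wheel. The space \<open>W\<close> will be the cycle space of \<open>F\<close>.\<close>

lemma three_connected_cycle_space_generated:
  assumes G: "is_graph G" and simple: "no_parallel_edges G" and con: "three_connected G"
    and n: "5 \<le> card (vertex_set G)" and W: "binary_space E' W"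
    and short: "\<And>C. circuit G C \<Longrightarrow> card C + 2 \<le> card (vertex_set G) \<Longrightarrow> C \<in> W"
    and "C \<in> cycle_space G"
  shows "C \<in> W"
  using \<open>C \<in> cycle_space G\<close>
proof (induction "card C" arbitrary: C rule: less_induct)
  case less
  interpret binary_space "edge_set G" "cycle_space G" by (rule binary_space_cycle_space[OF G])
  interpret W: binary_space E' W by fact
  have CE: "C \<subseteq> edge_set G" by (rule Z_subset[OF less.prems])
  have finC: "finite C" by (rule finite_subset[OF CE finite_E])
  \<comment> \<open>It suffices to write \<open>C\<close> as the sum of two smaller even
    sets.\<close>
  have split: "C \<in> W" if D: "D \<in> cycle_space G" "card D < card C" "card (sym_diff C D) < card C" for D
  proof -
    have "sym_diff D (sym_diff C D) \<in> W"
      using less.hyps D sym_diff_Z[OF less.prems D(1)] by (intro W.sym_diff_Z[of D "sym_diff C D"]) simp_all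
    moreover have "sym_diff D (sym_diff C D) = C" by blast
    ultimately show ?thesis by simp
  qed
  consider "C = {}" | "C \<noteq> {}" "\<not> circuit G C" | "circuit G C" by blast
  then show ?case
  proof cases
    case 1
    then show ?thesis using W.empty_Z by simp
  next
    case 2
    then obtain D where D: "D \<in> cycle_space G" "D \<subseteq> C" "D \<noteq> {}" "D \<noteq> C"
      using less.prems unfolding circuit_def by blast
    have "sym_diff C D \<subset> C" "D \<subset> C" using D by blast+
    then show ?thesis using split[OF D(1)] psubset_card_mono[OF finC] by blast
  next
    case 3
    let ?U = "\<Union> (end_vertices G ` C)"
    show ?thesis
    proof (cases "card C + 2 \<le> card (vertex_set G)")
      case True
      then show ?thesis using short 3 by blast
    next
      case False
      show ?thesis
      proof (cases "\<exists>f. f \<in> edge_set G \<and> end_vertices G f \<subseteq> ?U \<and> f \<notin> C")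
        case True
        then obtain f where f: "f \<in> edge_set G" "end_vertices G f \<subseteq> ?U" "f \<notin> C" by blast
        have "card (end_vertices G f) = 2" using f G unfolding is_graph_def by blast
        then obtain a b where ab: "end_vertices G f = {a, b}" "a \<noteq> b" unfolding card_2_iff by blast
        then have "a \<in> ?U" "b \<in> ?U" using f(2) by blast+
        then obtain P where P: "P \<subseteq> C" "odd_vertices G P = sym_diff {a} {b}"
          by (rule circuit_path[OF G 3])
        have finP: "finite P" by (rule finite_subset[OF P(1) finC])
        \<comment> \<open>Each of the two arcs \<open>P\<close> and \<open>C - P\<close> has at
          least two edges, because a single edge would be parallel to \<open>f\<close>. So closing
          either arc with \<open>f\<close> gives fewer edges than \<open>C\<close> has.\<close>
        have card_ge: "2 \<le> card Q" if Q: "Q \<subseteq> C" "odd_vertices G Q = {a, b}" for Q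
        proof -
          have "Q \<noteq> {}" using Q(2) by auto
          moreover have "Q \<noteq> {e}" for e
          proof
            assume "Q = {e}"
            then have "end_vertices G e = end_vertices G f" "e \<in> C" using Q ab by simp_all
            then show False using simple f CE unfolding no_parallel_edges_def by (metis inj_onD subsetD)
          qed
          moreover have "finite Q" by (rule finite_subset[OF Q(1) finC])
          ultimately have "card Q \<noteq> 0" "card Q \<noteq> 1" by (auto simp: card_1_singleton_iff)
          then show ?thesis by simp
        qed
        have Pab: "odd_vertices G P = {a, b}" using P(2) ab(2) by blast
        have "odd_vertices G (sym_diff C P) = {a, b}"
          using odd_vertices_sym_diff[OF finC finP, of G] Pab less.prems unfolding cycle_space_def by simp
        moreover have CP: "sym_diff C P = C - P" using P(1) by blast
        ultimately have "2 \<le> card (C - P)" using card_ge[of "C - P"] by simp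
        moreover have "2 \<le> card P" by (rule card_ge[OF P(1) Pab])
        moreover have "card C = card P + card (C - P)"
          using card_Diff_subset[OF finP P(1)] card_mono[OF finC P(1)] by simp
        moreover have fP: "f \<notin> P" using f(3) P(1) by blast
        moreover have "sym_diff C (insert f P) = insert f (C - P)" using f(3) P(1) by blast
        ultimately have "card (insert f P) < card C" "card (sym_diff C (insert f P)) < card C"
          using finP finC f(3) by simp_all
        moreover have "insert f P \<in> cycle_space G"
        proof -
          have "insert f P = sym_diff P {f}" using fP by blast
          then have "odd_vertices G (insert f P) = {}"
            using odd_vertices_sym_diff[OF finP, of "{f}" G] Pab ab(1) by simp
          then show ?thesis using f(1) P(1) CE unfolding cycle_space_def by blast
        qed
        ultimately show ?thesis using split by blast
      next
        case False
        then have chordless: "\<And>f. f \<in> edge_set G \<Longrightarrow> end_vertices G f \<subseteq> ?U \<Longrightarrow> f \<in> C" by blast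
        \<comment> \<open>With at least five vertices, a circuit that is not short has at least four
          edges, so triangles fall under the induction hypothesis. In K4 the rim would itself be a
          triangle.\<close>
        have long: "card (vertex_set G) < card C + 2" "2 \<le> card C" "3 < card C"
          using \<open>\<not> card C + 2 \<le> card (vertex_set G)\<close> n by simp_all
        obtain v s where v: "v \<notin> ?U"
          and s: "\<And>x. x \<in> ?U \<Longrightarrow> s x \<in> edge_set G \<and> end_vertices G (s x) = {x, v}"
          using chordless_long_circuit[OF G con 3 long(1,2) chordless] by blast
        have "\<And>D. D \<in> cycle_space G \<Longrightarrow> card D = 3 \<Longrightarrow> D \<in> W" using less.hyps long(3) by simp
        then show ?thesis using wheel_rim_in_span[OF G W less.prems v s] by blast
      qed
    qed
  qed
qed

subsection \<open>Vertex stars from the cycle space\<close>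

text \<open>Deleting \<open>v\<close> leaves a connected graph, so an edge \<open>g\<close> of
  \<open>X\<close> meets an edge \<open>h\<close> outside \<open>X\<close> at some \<open>x\<close>.
  Deleting \<open>v\<close> and \<open>x\<close> also leaves a connected graph, so the far ends of
  \<open>g\<close> and \<open>h\<close> are joined there. The even set closed in this way meets
  \<open>X\<close> in a set with odd degree at \<open>x\<close>.\<close>

lemma three_connected_complement_star_connected:
  assumes G: "is_graph G" and con: "three_connected G" and v: "v \<in> vertex_set G"
    and X: "X \<subseteq> edge_set G - vertex_star G v" "X \<noteq> {}" "X \<noteq> edge_set G - vertex_star G v"
  obtains C where "C \<in> cycle_space G" "C \<subseteq> edge_set G - vertex_star G v" "C \<inter> X \<notin> cycle_space G"
proof -
  let ?H = "edge_set G - vertex_star G v"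
  have avoid: "e \<in> ?H \<longleftrightarrow> e \<in> edge_set G \<and> v \<notin> end_vertices G e" for e
    unfolding vertex_star_def by blast
  have fin: "finite (edge_set G)" using G unfolding is_graph_def by blast
  have "\<exists>x g h. g \<in> X \<and> h \<in> ?H - X \<and> x \<in> end_vertices G g \<and> x \<in> end_vertices G h"
  proof (rule ccontr)
    assume no: "\<not> ?thesis"
    obtain g h where g: "g \<in> X" and h: "h \<in> ?H - X" using X by blast
    have nonempty: "end_vertices G e \<noteq> {}" if "e \<in> edge_set G" for e
      using that G unfolding is_graph_def by fastforce
    obtain u where u: "u \<in> end_vertices G g" using nonempty[of g] g X(1) by blast
    obtain w where w: "w \<in> end_vertices G h" using nonempty[of h] h by blast
    have "u \<in> vertex_set G - {v}"
    proof -
      have "g \<in> ?H" using g X(1) by blast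
      then show ?thesis using avoid[of g] u G unfolding is_graph_def by blast
    qed
    moreover have "w \<in> vertex_set G - {v}"
    proof -
      have "h \<in> ?H" using h by blast
      then show ?thesis using avoid[of h] w G unfolding is_graph_def by blast
    qed
    ultimately have "(u, w) \<in> (edge_relation G {e \<in> edge_set G. end_vertices G e \<inter> {v} = {}})\<^sup>*"
      using three_connected_reachable[OF con, of "{v}" u w] v by simp
    moreover have "{e \<in> edge_set G. end_vertices G e \<inter> {v} = {}} = ?H"
      unfolding vertex_star_def by blast
    ultimately have "(u, w) \<in> (edge_relation G ?H)\<^sup>*" by simp
    \<comment> \<open>If no edge of \<open>X\<close> met an edge outside \<open>X\<close>,
      membership in \<open>X\<close> would spread along the walk from \<open>u\<close> to
      \<open>w\<close>.\<close>
    then have "\<exists>e\<in>X. w \<in> end_vertices G e"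
    proof (induction rule: rtrancl_induct)
      case base
      then show ?case using g u by blast
    next
      case (step y z)
      from step.hyps(2) obtain e where e: "e \<in> ?H" "end_vertices G e = {y, z}"
        unfolding edge_relation_def by blast
      have "y \<in> end_vertices G e" using e(2) by blast
      then have "e \<in> X" using no step.IH e(1) by blast
      then show ?case using e(2) by blast
    qed
    then show False using no h w by blast
  qed
  then obtain x g h where gX: "g \<in> X" and h: "h \<in> ?H" "h \<notin> X"
    and xg: "x \<in> end_vertices G g" and xh: "x \<in> end_vertices G h" by blast
  have gH: "g \<in> ?H" using gX X(1) by blast
  have gE: "g \<in> edge_set G" "v \<notin> end_vertices G g" using gH avoid by blast+
  have hE: "h \<in> edge_set G" "v \<notin> end_vertices G h" using h(1) avoid by blast+
  obtain a where a: "end_vertices G g = {x, a}" "x \<noteq> a" "x \<in> vertex_set G" "a \<in> vertex_set G"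
    by (rule is_graph_ends[OF G gE(1) xg])
  obtain b where b: "end_vertices G h = {x, b}" "x \<noteq> b" "x \<in> vertex_set G" "b \<in> vertex_set G"
    by (rule is_graph_ends[OF G hE(1) xh])
  have "card {v, x} < 3" by (simp add: card_insert_if)
  moreover have "{v, x} \<subseteq> vertex_set G" using v a by simp
  moreover have "a \<in> vertex_set G - {v, x}" "b \<in> vertex_set G - {v, x}" using a b gE hE by auto
  ultimately obtain P where P: "P \<subseteq> edge_set G" "\<And>e. e \<in> P \<Longrightarrow> end_vertices G e \<inter> {v, x} = {}"
      "odd_vertices G P = sym_diff {a} {b}"
    using three_connected_path[OF G con, of "{v, x}" a b] by metis
  have finP: "finite P" by (rule finite_subset[OF P(1) fin])
  have gh: "g \<noteq> h" using gX h by blast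
  have nP: "g \<notin> P" "h \<notin> P" using P(2) xg xh by blast+
  let ?C = "sym_diff P (sym_diff {g} {h})"
  have C: "?C = insert g (insert h P)" using gh nP by blast
  have "odd_vertices G ?C = sym_diff (sym_diff {a} {b}) (sym_diff {x, a} {x, b})"
    using odd_vertices_sym_diff[of P "sym_diff {g} {h}" G] odd_vertices_sym_diff[of "{g}" "{h}" G]
      finP P(3) a(1) b(1) by simp
  also have "\<dots> = {}" using a(2) b(2) by blast
  finally have "?C \<in> cycle_space G" unfolding cycle_space_def using C P(1) gE hE by simp
  moreover have "?C \<subseteq> ?H"
    unfolding C using gH h(1) P(1,2) avoid by blast
  moreover have "?C \<inter> X \<notin> cycle_space G"
  proof -
    \<comment> \<open>The edges of \<open>P\<close> avoid \<open>x\<close> and \<open>h\<close> is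
      not in \<open>X\<close>, so \<open>g\<close> alone is left at \<open>x\<close>.\<close>
    have "{e \<in> ?C \<inter> X. x \<in> end_vertices G e} = {g}"
      unfolding C using P(2) gX h xg by blast
    then have "x \<in> odd_vertices G (?C \<inter> X)" unfolding odd_vertices_def by simp
    then show ?thesis unfolding cycle_space_def by blast
  qed
  ultimately show ?thesis by (rule that)
qed

text \<open>Stars are orthogonal to even sets. Once the cycle spaces agree, a star of one graph
  meets the even sets of the other evenly too.\<close>

lemma even_card_star_Int:
  assumes "C \<in> cycle_space G"
  shows "even (card (C \<inter> vertex_star G v))"
proof -
  have "C \<inter> vertex_star G v = {e \<in> C. v \<in> end_vertices G e}"
    using assms unfolding cycle_space_def vertex_star_def by blast
  then show ?thesis using assms unfolding cycle_space_def odd_vertices_def by auto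
qed

text \<open>Let \<open>d\<close> join \<open>p\<close> and \<open>q\<close> in \<open>F\<close>. If
  neither star lay inside the star of \<open>v\<close>, the edges of \<open>G\<close> away from
  \<open>v\<close> would connect \<open>p\<close> to \<open>q\<close> in \<open>F\<close>; closing
  this connection with \<open>d\<close> gives an even set that meets the star of \<open>v\<close> in
  \<open>d\<close> alone.\<close>

lemma star_subset_star_of_same_cycle_space:
  fixes G :: "('v, 'e) graph" and F :: "('w, 'e) graph"
  assumes G: "is_graph G" and con: "three_connected G" and F: "is_graph F"
    and E: "edge_set F = edge_set G" and eq: "cycle_space F = cycle_space G"
    and v: "v \<in> vertex_set G" and d: "d \<in> vertex_star G v"
  obtains s where "s \<in> vertex_set F" "d \<in> vertex_star F s" "vertex_star F s \<subseteq> vertex_star G v"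
proof -
  let ?H = "edge_set G - vertex_star G v"
  have dE: "d \<in> edge_set F" using d E unfolding vertex_star_def by blast
  have finH: "finite ?H" using G unfolding is_graph_def by simp
  have "card (end_vertices F d) = 2" and dV: "end_vertices F d \<subseteq> vertex_set F"
    using dE F unfolding is_graph_def by blast+
  then obtain p q where pq: "end_vertices F d = {p, q}" "p \<noteq> q" unfolding card_2_iff by blast
  have "vertex_star F p \<subseteq> vertex_star G v \<or> vertex_star F q \<subseteq> vertex_star G v"
  proof (rule ccontr)
    assume "\<not> ?thesis"
    then obtain g h where g: "g \<in> ?H" "p \<in> end_vertices F g" and h: "h \<in> ?H" "q \<in> end_vertices F h"
      using E unfolding vertex_star_def by auto
    \<comment> \<open>The edges of \<open>?H\<close> in the component of \<open>p\<close> in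
      \<open>F\<close>. Every even set inside \<open>?H\<close> meets \<open>X\<close> in an even
      set, so \<open>three_connected_complement_star_connected\<close> forces
      \<open>X = ?H\<close>.\<close>
    define X where "X = {e \<in> ?H. \<exists>x\<in>end_vertices F e. (p, x) \<in> (edge_relation F ?H)\<^sup>*}"
    have HF: "?H \<subseteq> edge_set F" using E by blast
    have XH: "X \<subseteq> ?H" unfolding X_def by blast
    have gX: "g \<in> X" unfolding X_def using g by blast
    have step: "(p, y) \<in> (edge_relation F ?H)\<^sup>*" if e: "e \<in> X" "y \<in> end_vertices F e" for e y
      using e reachable_edge_ends[OF F HF] unfolding X_def by blast
    have "X = ?H"
    proof (rule ccontr)
      assume "X \<noteq> ?H"
      then obtain C where C: "C \<in> cycle_space G" "C \<subseteq> ?H" "C \<inter> X \<notin> cycle_space G"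
        using three_connected_complement_star_connected[OF G con v XH] gX by blast
      have CF: "C \<in> cycle_space F" using C(1) eq by simp
      have "{e \<in> C \<inter> X. w \<in> end_vertices F e} =
          (if (p, w) \<in> (edge_relation F ?H)\<^sup>* then {e \<in> C. w \<in> end_vertices F e} else {})" for w
        using step C(2) unfolding X_def by auto
      then have "odd_vertices F (C \<inter> X) = {}"
        using CF unfolding cycle_space_def odd_vertices_def by auto
      then have "C \<inter> X \<in> cycle_space F" using XH E unfolding cycle_space_def by blast
      then show False using C(3) eq by simp
    qed
    then have "(p, q) \<in> (edge_relation F ?H)\<^sup>*" using step h by blast
    then obtain P where P: "P \<subseteq> ?H" "odd_vertices F P = sym_diff {p} {q}"
      by (rule edge_relation_path[OF finH])
    have finP: "finite P" by (rule finite_subset[OF P(1) finH])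
    have ins: "sym_diff P {d} = insert d P" using P(1) d by blast
    have "odd_vertices F (sym_diff P {d}) = {}"
      using odd_vertices_sym_diff[OF finP, of "{d}" F] P(2) pq by auto
    then have "insert d P \<in> cycle_space F"
      unfolding ins cycle_space_def using dE P(1) E by blast
    then have "even (card (insert d P \<inter> vertex_star G v))"
      unfolding eq by (rule even_card_star_Int)
    moreover have "insert d P \<inter> vertex_star G v = {d}" using P(1) d by blast
    ultimately show False by simp
  qed
  moreover have "p \<in> vertex_set F" "q \<in> vertex_set F" "d \<in> vertex_star F p" "d \<in> vertex_star F q"
    using pq dV dE unfolding vertex_star_def by auto
  ultimately show ?thesis using that by blast
qed

text \<open>The star of \<open>v\<close> is a minimal cut: for any two of its edges \<open>d\<close>
  and \<open>f\<close>, some even set meets it in exactly these two. The star of \<open>s\<close>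
  contains \<open>d\<close> and meets this even set evenly, so it contains \<open>f\<close>.\<close>

lemma star_eq_star_of_same_cycle_space:
  fixes G :: "('v, 'e) graph" and F :: "('w, 'e) graph"
  assumes G: "is_graph G" and con: "three_connected G" and F: "is_graph F"
    and E: "edge_set F = edge_set G" and eq: "cycle_space F = cycle_space G"
    and v: "v \<in> vertex_set G" and "vertex_star G v \<noteq> {}"
  shows "\<exists>s\<in>vertex_set F. vertex_star F s = vertex_star G v"
proof -
  obtain d where d: "d \<in> vertex_star G v" using assms by blast
  obtain s where s: "s \<in> vertex_set F" "d \<in> vertex_star F s" "vertex_star F s \<subseteq> vertex_star G v"
    by (rule star_subset_star_of_same_cycle_space[OF G con F E eq v d])
  have fin: "finite (edge_set G)" using G unfolding is_graph_def by blast
  have "f \<in> vertex_star F s" if f: "f \<in> vertex_star G v" for f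
  proof (cases "f = d")
    case False
    have dv: "d \<in> edge_set G" "v \<in> end_vertices G d" and fv: "f \<in> edge_set G" "v \<in> end_vertices G f"
      using d f unfolding vertex_star_def by blast+
    obtain a where a: "end_vertices G d = {v, a}" "v \<noteq> a" "v \<in> vertex_set G" "a \<in> vertex_set G"
      by (rule is_graph_ends[OF G dv])
    obtain b where b: "end_vertices G f = {v, b}" "v \<noteq> b" "v \<in> vertex_set G" "b \<in> vertex_set G"
      by (rule is_graph_ends[OF G fv])
    obtain P where P: "P \<subseteq> edge_set G" "\<And>e. e \<in> P \<Longrightarrow> end_vertices G e \<inter> {v} = {}"
      "odd_vertices G P = sym_diff {a} {b}"
      by (rule three_connected_path[OF G con, of "{v}" a b]) (use a b in auto)
    have finP: "finite P" by (rule finite_subset[OF P(1) fin])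
    let ?C = "sym_diff P (sym_diff {d} {f})"
    have Pv: "P \<inter> vertex_star G v = {}" using P(2) unfolding vertex_star_def by blast
    have C: "?C = insert d (insert f P)" using Pv d f False by blast
    have "odd_vertices G ?C = sym_diff (sym_diff {a} {b}) (sym_diff {v, a} {v, b})"
      using odd_vertices_sym_diff[of P "sym_diff {d} {f}" G] odd_vertices_sym_diff[of "{d}" "{f}" G]
        finP P(3) a(1) b(1) by simp
    also have "\<dots> = {}" using a(2) b(2) by blast
    finally have "?C \<in> cycle_space F" unfolding eq unfolding cycle_space_def using C P(1) dv fv by simp
    then have even: "even (card (?C \<inter> vertex_star F s))" by (rule even_card_star_Int)
    show ?thesis
    proof (rule ccontr)
      assume "f \<notin> vertex_star F s"
      then have "?C \<inter> vertex_star F s = {d}" unfolding C using s(2,3) Pv by blast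
      then have "card (?C \<inter> vertex_star F s) = 1" by simp
      then show False using even by simp
    qed
  qed (use s in simp)
  then have "vertex_star F s = vertex_star G v" using s(3) by blast
  then show ?thesis using s(1) by blast
qed

section \<open>The cycle space and the stars from the truncated cycle matroid\<close>

lemma truncated_cycle_matroid_bases:
  assumes "is_graph G"
  shows "bases (truncated_cycle_matroid G) =
    binary_space.truncated_bases (edge_set G) (cycle_space G)"
  unfolding truncated_cycle_matroid_def truncation_def cycle_matroid_def
    binary_space.truncated_bases_def[OF binary_space_cycle_space[OF assms]]
  using maximal_forest_edges_iff_basis[OF assms] by simp

text \<open>The truncation fixes the rank and the independent sets below it, so the short circuits
  of \<open>G\<close> are even in \<open>F\<close>. They generate the cycle space of
  \<open>G\<close>, and equal ranks turn inclusion into equality.\<close>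

lemma cycle_space_eq_of_truncated_cycle_matroid_eq:
  fixes G :: "('v, 'e) graph" and F :: "('w, 'e) graph"
  assumes G: "is_graph G" and simple: "no_parallel_edges G" and con: "three_connected G"
    and n: "5 \<le> card (vertex_set G)" and F: "is_graph F" and E: "edge_set F = edge_set G"
    and eq: "truncated_cycle_matroid F = truncated_cycle_matroid G"
  shows "cycle_space F = cycle_space G"
proof -
  let ?E = "edge_set G"
  have spG: "binary_space ?E (cycle_space G)" by (rule binary_space_cycle_space[OF G])
  have spF: "binary_space ?E (cycle_space F)" using binary_space_cycle_space[OF F] E by simp
  interpret g: binary_space ?E "cycle_space G" by (rule spG)
  interpret f: binary_space ?E "cycle_space F" by (rule spF)
  have trunc: "g.truncated_bases = f.truncated_bases"
    using truncated_cycle_matroid_bases[OF G] truncated_cycle_matroid_bases[OF F] eq E by simp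
  have "g.indep {}" "f.indep {}" unfolding g.indep_def f.indep_def by blast+
  then obtain B B' where B: "g.basis B" and B': "f.basis B'"
    using g.indep_extend f.indep_extend by metis
  \<comment> \<open>The rank is at least the number of vertices minus one. Short circuits therefore
    lie strictly below the rank, and the basis is nonempty.\<close>
  have rank: "card (vertex_set G) \<le> Suc (card B)"
    by (rule connected_basis_card[OF G three_connected_imp_connected[OF con] B])
  then have "B \<noteq> {}" using n by auto
  then have cards: "card B' = card B"
    by (rule truncated_bases_same_rank[OF spG spF trunc B _ B'])
  have small: "g.indep A \<longleftrightarrow> f.indep A" if "card A < card B" for A
    using g.indep_small_iff_truncated[OF B that] f.indep_small_iff_truncated[OF B', of A] trunc cards that
    by simp
  have "C \<in> cycle_space F" if C: "circuit G C" "card C + 2 \<le> card (vertex_set G)" for C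
  proof -
    have CZ: "C \<in> cycle_space G" "C \<noteq> {}"
      and min: "\<And>D. D \<in> cycle_space G \<Longrightarrow> D \<subseteq> C \<Longrightarrow> D = {} \<or> D = C"
      using C(1) unfolding circuit_def by blast+
    have CE: "C \<subseteq> ?E" by (rule g.Z_subset[OF CZ(1)])
    have finC: "finite C" by (rule finite_subset[OF CE g.finite_E])
    have cC: "card C < card B" using C(2) rank by simp
    have "\<not> g.indep C" unfolding g.indep_def using CZ by blast
    then have "\<not> f.indep C" using small[OF cC] by simp
    then obtain D where D: "D \<in> cycle_space F" "D \<subseteq> C" "D \<noteq> {}"
      using CE unfolding f.indep_def by blast
    \<comment> \<open>A proper part of the circuit is independent in \<open>G\<close> and, being
      small, independent in \<open>F\<close> too.\<close>
    have "D = C"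
    proof (rule ccontr)
      assume "D \<noteq> C"
      have "g.indep D" unfolding g.indep_def
      proof (intro conjI ballI impI)
        show "D \<subseteq> ?E" using D(2) CE by blast
        fix D' assume "D' \<in> cycle_space G" "D' \<subseteq> D"
        then show "D' = {}" using min[of D'] D(2) \<open>D \<noteq> C\<close> by blast
      qed
      moreover have "card D < card B" using card_mono[OF finC D(2)] cC by simp
      ultimately have "f.indep D" using small by blast
      then show False using D unfolding f.indep_def by blast
    qed
    then show ?thesis using D(1) by simp
  qed
  then have "cycle_space G \<subseteq> cycle_space F"
    using three_connected_cycle_space_generated[OF G simple con n spF] by blast
  then have "cycle_space G = cycle_space F"
    by (rule binary_space_eqI[OF spG spF _ B B' cards])
  then show ?thesis ..
qed

theorem claim3p14:
  fixes G :: "('v, 'e) graph" and F :: "('w, 'e) graph"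
  assumes "admissible_graph G"
    and "three_connected G"
    and "\<not> isomorphic_graphs G (complete_graph 4)"
    and "admissible_graph F"
    and "edge_set F = edge_set G"
    and "truncated_cycle_matroid F = truncated_cycle_matroid G"
  shows "strongly_isomorphic F G"
proof -
  have G: "is_graph G" and simple: "no_parallel_edges G" and isoG: "no_isolated_vertices G"
    and F: "is_graph F" and isoF: "no_isolated_vertices F"
    using assms(1,4) unfolding admissible_graph_def by blast+
  note con = assms(2) and E = assms(5)
  have n: "5 \<le> card (vertex_set G)" by (rule three_connected_card_ge_5[OF assms(1-3)])
  have eq: "cycle_space F = cycle_space G"
    by (rule cycle_space_eq_of_truncated_cycle_matroid_eq[OF G simple con n F E assms(6)])
  have "\<forall>v\<in>vertex_set G. \<exists>s. s \<in> vertex_set F \<and> vertex_star F s = vertex_star G v"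
    using star_eq_star_of_same_cycle_space[OF G con F E eq] isoG unfolding no_isolated_vertices_def by blast
  then obtain \<phi> where \<phi>: "\<forall>v\<in>vertex_set G. \<phi> v \<in> vertex_set F \<and> vertex_star F (\<phi> v) = vertex_star G v"
    by (rule bchoice[THEN exE])
  \<comment> \<open>Two vertices with the same star would meet only edges joining the two, hence at
    most one edge, against degree at least three.\<close>
  have inj: "inj_on \<phi> (vertex_set G)"
  proof (rule inj_onI, rule ccontr)
    fix u v assume uv: "u \<in> vertex_set G" "v \<in> vertex_set G" "\<phi> u = \<phi> v" "u \<noteq> v"
    then have star: "vertex_star G u = vertex_star G v" using \<phi> by metis
    have ends: "end_vertices G e = {u, v}" "e \<in> edge_set G" if e: "e \<in> vertex_star G u" for e
    proof -
      have "u \<in> end_vertices G e" "v \<in> end_vertices G e" and eE: "e \<in> edge_set G"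
        using e star unfolding vertex_star_def by blast+
      then show "end_vertices G e = {u, v}" using uv(4) is_graph_ends[OF G eE, of u] by blast
      show "e \<in> edge_set G" by (rule eE)
    qed
    have "finite (vertex_star G u)" using G unfolding is_graph_def vertex_star_def by simp
    moreover have "\<forall>e\<in>vertex_star G u. \<forall>e'\<in>vertex_star G u. e = e'"
      using ends simple unfolding no_parallel_edges_def by (metis inj_onD)
    ultimately have "card (vertex_star G u) \<le> 1" by (simp add: card_le_Suc0_iff_eq)
    then show False using three_connected_degree[OF G con uv(1)] by simp
  qed
  \<comment> \<open>Since \<open>w\<close> is not isolated, it is an end in \<open>F\<close> of some
    edge. With \<open>u\<close> and \<open>v\<close> the ends of this edge in \<open>G\<close>, its
    ends in \<open>F\<close> are the distinct vertices \<open>\<phi> u\<close> and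
    \<open>\<phi> v\<close>, so \<open>w\<close> is one of them.\<close>
  have image: "\<phi> ` vertex_set G = vertex_set F"
  proof (intro subset_antisym subsetI)
    fix w assume w: "w \<in> vertex_set F"
    then obtain e where e: "e \<in> edge_set F" "w \<in> end_vertices F e"
      using isoF unfolding no_isolated_vertices_def vertex_star_def by blast
    then have eG: "e \<in> edge_set G" using E by simp
    have "card (end_vertices G e) = 2" "end_vertices G e \<subseteq> vertex_set G"
      using eG G unfolding is_graph_def by blast+
    then obtain u v where uv: "end_vertices G e = {u, v}" "u \<noteq> v" "u \<in> vertex_set G" "v \<in> vertex_set G"
      unfolding card_2_iff by auto
    then have "e \<in> vertex_star F (\<phi> u)" "e \<in> vertex_star F (\<phi> v)"
      using \<phi> eG by (simp_all add: vertex_star_def[of G])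
    then have mem: "\<phi> u \<in> end_vertices F e" "\<phi> v \<in> end_vertices F e"
      unfolding vertex_star_def by blast+
    have "\<phi> u \<noteq> \<phi> v" using inj uv by (metis inj_onD)
    moreover obtain z where "end_vertices F e = {w, z}" by (rule is_graph_ends[OF F e])
    ultimately have "w = \<phi> u \<or> w = \<phi> v" using mem by auto
    then show "w \<in> \<phi> ` vertex_set G" using uv(3,4) by blast
  qed (use \<phi> in blast)
  have "vertex_stars F = image_mset (vertex_star F) (image_mset \<phi> (mset_set (vertex_set G)))"
    unfolding vertex_stars_def image_mset_mset_set[OF inj] image ..
  also have "\<dots> = image_mset (vertex_star G) (mset_set (vertex_set G))"
  proof -
    have "finite (vertex_set G)" using G unfolding is_graph_def by blast
    then show ?thesis unfolding multiset.map_comp using \<phi> by (intro image_mset_cong) simp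
  qed
  finally show ?thesis unfolding strongly_isomorphic_def vertex_stars_def .
qed

end
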